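(* Let $1<\beta<2$, $\mu>0$, $T>0$ and $a<b$. The following finite difference scheme for the time-fractional diffusion-wave equation is stable, in the sense of Fourier analysis defined in the context, for all step sizes $\tau=T/n_T$ and $h=(b-a)/N$ (with no restriction on $\tau^{\beta}/h^2$): find $u_j^n$, $1\le j\le N-1$, $1\le n\le n_T$, such that $$\sum_{k=0}^n\alpha_{n-k}(u_j^{k}-\varphi_j^k)=\mu\tau^{\beta}\sum_{k=0}^n\theta_{n-k}\left(\delta^2_xu_j^k-\delta^2_x\varphi_j^k\right)+\mu\sum_{k=0}^n\alpha_{n-k}\delta_x^2\Phi^k_j+\sum_{k=0}^n\alpha_{n-k}F^k_j,$$ with $u_0^k=U_a(t_k)$, $u_N^k=U_b(t_k)$ for $0\le k\le n_T$ and $u_j^0=\phi_0(x_j)$, where $\alpha_k=(-1)^k\binom{\beta}{k}$ and $\theta_k=2^{-\beta}(-1)^k\alpha_k=2^{-\beta}\binom{\beta}{k}$.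
   Context: **Problem and notation.** The scheme approximates the problem $${}_{C}D_{0,t}^{\beta}U(x,t)=\mu\,\partial_x^2U(x,t)+f(x,t),\quad (x,t)\in(a,b)\times(0,T],$$ $U(x,0)=\phi_0(x)$, $\partial_tU(x,0)=\psi_0(x)$, $U(a,t)=U_a(t)$, $U(b,t)=U_b(t)$, where ${}_{C}D_{0,t}^{\beta}U(x,t)=\frac{1}{\Gamma(2-\beta)}\int_0^t(t-s)^{1-\beta}\partial_s^2U(x,s)\,ds$ is the Caputo derivative. The fractional integral is $D^{-\beta}_{0,t}g(t)=\frac{1}{\Gamma(\beta)}\int_0^t(t-s)^{\beta-1}g(s)\,ds$. The grid is $t_n=n\tau$ ($0\le n\le n_T$), $x_j=a+jh$ ($0\le j\le N$), with $n_T,N$ positive integers, and $\delta_x^2v_j=(v_{j+1}-2v_j+v_{j-1})/h^2$. Further, $$\varphi_j^k=\phi_0(x_j)+\psi_0(x_j)t_k,\quad \Phi_j^k=\frac{\phi_0(x_j)t_k^{\beta}}{\Gamma(\beta+1)}+\frac{\psi_0(x_j)t_k^{\beta+1}}{\Gamma(\beta+2)},\quad F_j^k=\left[D^{-\beta}_{0,t}f(x_j,t)\right]_{t=t_k}.$$ **Stability (Fourier analysis).** Put $$A_n=\frac{1}{\Gamma(\beta+1)}\sum_{k=0}^n\alpha_{n-k}k^{\beta}-\sum_{k=0}^n\theta_{n-k},\qquad B_n=\frac{1}{\Gamma(\beta+2)}\sum_{k=0}^n\alpha_{n-k}k^{\beta+1}-\sum_{k=0}^n\theta_{n-k}k.$$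 Substituting a Fourier mode $u_j^n=\rho^n e^{ij\sigma h}$ ($i^2=-1$, $\sigma\in\mathbb{R}$; $\rho^n$ denotes the amplitude at level $n$, not a power), with $\phi_0(x_j)=\rho^0e^{ij\sigma h}$, $\psi_0(x_j)=d_0e^{ij\sigma h}$ and $F_j^k=0$, into the interior equation of the scheme gives the amplitude equation $$\sum_{k=0}^n\alpha_{n-k}(\rho^k-\rho^0-d_0t_k)=S^*\left[\sum_{k=0}^n\theta_{n-k}\rho^k+A_n\rho^0+B_nd_0\tau\right],\quad n\ge1,\qquad S^*=-\frac{4\mu\tau^{\beta}}{h^2}\sin^2\left(\frac{\sigma h}{2}\right).$$ The scheme is called stable (for all step sizes) if, for all $\tau,h>0$, all $\sigma\in\mathbb{R}$ and all $\rho^0,d_0\in\mathbb{C}$, the sequence $(\rho^n)$ determined by the amplitude equation is bounded as $n\to\infty$ (i.e. bounded over all $n\ge0$) when $S^*<0$, and when $S^*=0$ it is bounded on $0\le n\le n_T$ (i.e. for $n\tau\le T$) by a constant depending only on $\rho^0,d_0,T$. *)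

theory Defs
  imports "HOL-Analysis.Analysis"
begin

section \<open>The finite difference scheme\<close>

definition alpha :: "real \<Rightarrow> nat \<Rightarrow> real" where
  "alpha \<beta> k = (-1) ^ k * (\<beta> gchoose k)"

definition theta :: "real \<Rightarrow> nat \<Rightarrow> real" where
  "theta \<beta> k = 2 powr (-\<beta>) * (-1) ^ k * alpha \<beta> k"

definition frac_integral :: "real \<Rightarrow> (real \<Rightarrow> 'a::banach) \<Rightarrow> real \<Rightarrow> 'a" where
  "frac_integral \<beta> g t =
     (1 / Gamma \<beta>) *\<^sub>R integral {0..t} (\<lambda>s. ((t - s) powr (\<beta> - 1)) *\<^sub>R g s)"

definition grid_point :: "real \<Rightarrow> real \<Rightarrow> int \<Rightarrow> real" where
  "grid_point a h j = a + of_int j * h"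

definition second_diff :: "real \<Rightarrow> (int \<Rightarrow> 'a::real_vector) \<Rightarrow> int \<Rightarrow> 'a" where
  "second_diff h v j = (1 / h\<^sup>2) *\<^sub>R (v (j + 1) - 2 *\<^sub>R v j + v (j - 1))"

definition phi_term ::
    "real \<Rightarrow> real \<Rightarrow> real \<Rightarrow> (real \<Rightarrow> 'a::real_vector) \<Rightarrow> (real \<Rightarrow> 'a) \<Rightarrow> nat \<Rightarrow> int \<Rightarrow> 'a" where
  "phi_term \<tau> h a \<phi>0 \<psi>0 k j =
     \<phi>0 (grid_point a h j) + (real k * \<tau>) *\<^sub>R \<psi>0 (grid_point a h j)"

definition Phi_term ::
    "real \<Rightarrow> real \<Rightarrow> real \<Rightarrow> real \<Rightarrow> (real \<Rightarrow> 'a::real_vector) \<Rightarrow> (real \<Rightarrow> 'a)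
      \<Rightarrow> nat \<Rightarrow> int \<Rightarrow> 'a" where
  "Phi_term \<beta> \<tau> h a \<phi>0 \<psi>0 k j =
     ((real k * \<tau>) powr \<beta> / Gamma (\<beta> + 1)) *\<^sub>R \<phi>0 (grid_point a h j)
     + ((real k * \<tau>) powr (\<beta> + 1) / Gamma (\<beta> + 2)) *\<^sub>R \<psi>0 (grid_point a h j)"

text \<open>
  The interior equation at time level \<open>n\<close> and spatial index \<open>j\<close>. Grid functions take the time
  level first: \<open>u n j\<close> is the value at \<open>(x\<^sub>j, t\<^sub>n)\<close>. Values lie in a real vector space, so that
  the same equation covers real data and complex Fourier modes.
\<close>

definition interior_equation ::
    "real \<Rightarrow> real \<Rightarrow> real \<Rightarrow> real \<Rightarrow> real \<Rightarrow> (real \<Rightarrow> 'a::real_vector) \<Rightarrow> (real \<Rightarrow> 'a)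
      \<Rightarrow> (nat \<Rightarrow> int \<Rightarrow> 'a) \<Rightarrow> (nat \<Rightarrow> int \<Rightarrow> 'a) \<Rightarrow> nat \<Rightarrow> int \<Rightarrow> bool" where
  "interior_equation \<beta> \<mu> \<tau> h a \<phi>0 \<psi>0 F u n j \<longleftrightarrow>
     (\<Sum>k\<le>n. alpha \<beta> (n - k) *\<^sub>R (u k j - phi_term \<tau> h a \<phi>0 \<psi>0 k j))
     = (\<mu> * \<tau> powr \<beta>) *\<^sub>R (\<Sum>k\<le>n. theta \<beta> (n - k) *\<^sub>R
          (second_diff h (u k) j - second_diff h (phi_term \<tau> h a \<phi>0 \<psi>0 k) j))
       + \<mu> *\<^sub>R (\<Sum>k\<le>n. alpha \<beta> (n - k) *\<^sub>R second_diff h (Phi_term \<beta> \<tau> h a \<phi>0 \<psi>0 k) j)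
       + (\<Sum>k\<le>n. alpha \<beta> (n - k) *\<^sub>R F k j)"

definition scheme_solution ::
    "real \<Rightarrow> real \<Rightarrow> real \<Rightarrow> real \<Rightarrow> real \<Rightarrow> nat \<Rightarrow> nat \<Rightarrow> (real \<Rightarrow> 'a::banach) \<Rightarrow> (real \<Rightarrow> 'a)
      \<Rightarrow> (real \<Rightarrow> 'a) \<Rightarrow> (real \<Rightarrow> 'a) \<Rightarrow> (real \<Rightarrow> real \<Rightarrow> 'a) \<Rightarrow> (nat \<Rightarrow> int \<Rightarrow> 'a) \<Rightarrow> bool" where
  "scheme_solution \<beta> \<mu> T a b nT N \<phi>0 \<psi>0 Ua Ub f u \<longleftrightarrow>
     0 < nT \<and> 0 < N \<and>
     (let \<tau> = T / real nT; h = (b - a) / real N;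
          F = (\<lambda>k j. frac_integral \<beta> (f (grid_point a h j)) (real k * \<tau>))
      in (\<forall>n\<in>{1..nT}. \<forall>j\<in>{1..int N - 1}. interior_equation \<beta> \<mu> \<tau> h a \<phi>0 \<psi>0 F u n j)
         \<and> (\<forall>k\<le>nT. u k 0 = Ua (real k * \<tau>) \<and> u k (int N) = Ub (real k * \<tau>))
         \<and> (\<forall>j\<in>{1..int N - 1}. u 0 j = \<phi>0 (grid_point a h j)))"


section \<open>Fourier stability\<close>

definition fourier_mode :: "real \<Rightarrow> real \<Rightarrow> int \<Rightarrow> complex" where
  "fourier_mode \<sigma> h j = exp (\<i> * of_real (of_int j * \<sigma> * h))"

definition A_coeff :: "real \<Rightarrow> nat \<Rightarrow> real" where
  "A_coeff \<beta> n =
     1 / Gamma (\<beta> + 1) * (\<Sum>k\<le>n. alpha \<beta> (n - k) * real k powr \<beta>)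
     - (\<Sum>k\<le>n. theta \<beta> (n - k))"

definition B_coeff :: "real \<Rightarrow> nat \<Rightarrow> real" where
  "B_coeff \<beta> n =
     1 / Gamma (\<beta> + 2) * (\<Sum>k\<le>n. alpha \<beta> (n - k) * real k powr (\<beta> + 1))
     - (\<Sum>k\<le>n. theta \<beta> (n - k) * real k)"

definition S_star :: "real \<Rightarrow> real \<Rightarrow> real \<Rightarrow> real \<Rightarrow> real \<Rightarrow> real" where
  "S_star \<beta> \<mu> \<tau> h \<sigma> = - (4 * \<mu> * \<tau> powr \<beta> / h\<^sup>2) * (sin (\<sigma> * h / 2))\<^sup>2"

text \<open>In \<open>amplitude_equation\<close>, \<open>\<rho> n\<close> is the amplitude at time level \<open>n\<close>.\<close>

definition amplitude_equation ::
    "real \<Rightarrow> real \<Rightarrow> real \<Rightarrow> real \<Rightarrow> real \<Rightarrow> complex \<Rightarrow> (nat \<Rightarrow> complex) \<Rightarrow> nat \<Rightarrow> bool" where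
  "amplitude_equation \<beta> \<mu> \<tau> h \<sigma> d0 \<rho> n \<longleftrightarrow>
     (\<Sum>k\<le>n. of_real (alpha \<beta> (n - k)) * (\<rho> k - \<rho> 0 - d0 * of_real (real k * \<tau>)))
     = of_real (S_star \<beta> \<mu> \<tau> h \<sigma>) *
         ((\<Sum>k\<le>n. of_real (theta \<beta> (n - k)) * \<rho> k)
          + of_real (A_coeff \<beta> n) * \<rho> 0 + of_real (B_coeff \<beta> n) * d0 * of_real \<tau>)"

definition amplitude_sequence ::
    "real \<Rightarrow> real \<Rightarrow> real \<Rightarrow> real \<Rightarrow> real \<Rightarrow> complex \<Rightarrow> complex \<Rightarrow> (nat \<Rightarrow> complex) \<Rightarrow> bool" where
  "amplitude_sequence \<beta> \<mu> \<tau> h \<sigma> \<rho>0 d0 \<rho> \<longleftrightarrow>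
     \<rho> 0 = \<rho>0 \<and> (\<forall>n\<ge>1. amplitude_equation \<beta> \<mu> \<tau> h \<sigma> d0 \<rho> n)"

text \<open>
  The function \<open>K\<close> supplies the bound in the degenerate case \<open>S\<^sup>* = 0\<close>. It is a parameter so that
  it can be chosen before \<open>\<beta>\<close>, \<open>\<mu>\<close>, \<open>\<tau>\<close>, \<open>h\<close>, \<open>\<sigma>\<close>: the bound depends on the initial
  amplitudes and the final time only.
\<close>

definition fourier_stable ::
    "(complex \<Rightarrow> complex \<Rightarrow> real \<Rightarrow> real) \<Rightarrow> real \<Rightarrow> real \<Rightarrow> real \<Rightarrow> bool" where
  "fourier_stable K \<beta> \<mu> T \<longleftrightarrow>
     (\<forall>\<tau> h \<sigma> \<rho>0 d0 \<rho>. 0 < \<tau> \<longrightarrow> 0 < h \<longrightarrow> amplitude_sequence \<beta> \<mu> \<tau> h \<sigma> \<rho>0 d0 \<rho> \<longrightarrow>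
        (S_star \<beta> \<mu> \<tau> h \<sigma> < 0 \<longrightarrow> bounded (range \<rho>))
        \<and> (S_star \<beta> \<mu> \<tau> h \<sigma> = 0 \<longrightarrow>
            (\<forall>n. real n * \<tau> \<le> T \<longrightarrow> norm (\<rho> n) \<le> K \<rho>0 d0 T)))"


section \<open>The amplitude equation determines the amplitudes\<close>

lemma triangular_recursion:
  fixes c :: "'b::field" and r :: "(nat \<Rightarrow> 'b) \<Rightarrow> nat \<Rightarrow> 'b"
  assumes c: "c \<noteq> 0"
    and r: "\<And>f g n. (\<And>k. k < n \<Longrightarrow> f k = g k) \<Longrightarrow> r f n = r g n"
  shows "\<exists>!f. f 0 = f0 \<and> (\<forall>n\<ge>1. c * f n = r f n)"
proof -
  define G :: "(nat \<Rightarrow> 'b) \<Rightarrow> nat \<Rightarrow> 'b" where "G f n = (if n = 0 then f0 else r f n / c)" for f n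
  have adm: "adm_wf less_than G"
    unfolding adm_wf_def
  proof (intro allI impI)
    fix f g :: "nat \<Rightarrow> 'b" and n :: nat
    assume "\<forall>z. (z, n) \<in> less_than \<longrightarrow> f z = g z"
    then have "r f n = r g n" by (intro r) simp
    then show "G f n = G g n" by (simp only: G_def)
  qed
  define F where "F = wfrec less_than G"
  have F: "F n = G F n" for n
    using wfrec_fixpoint[OF wf_less_than adm] unfolding F_def by metis
  show ?thesis
  proof (rule ex1I[of _ F])
    show "F 0 = f0 \<and> (\<forall>n\<ge>1. c * F n = r F n)"
    proof (intro conjI allI impI)
      show "F 0 = f0" using F[of 0] by (simp add: G_def)
      show "c * F n = r F n" if "n \<ge> 1" for n
      proof -
        have "F n = r F n / c" using F[of n] that unfolding G_def by (metis not_one_le_zero)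
        then show ?thesis using c by (metis nonzero_mult_div_cancel_left times_divide_eq_right)
      qed
    qed
  next
    fix f assume f: "f 0 = f0 \<and> (\<forall>n\<ge>1. c * f n = r f n)"
    have "f n = F n" for n
    proof (induction n rule: less_induct)
      case (less n)
      show ?case
      proof (cases "n = 0")
        case True
        have "F 0 = f0" using F[of 0] by (simp add: G_def)
        then show ?thesis using f True by simp
      next
        case False
        have "r f n = r F n" using less by (intro r) auto
        moreover have "c * f n = r f n" using f False by auto
        moreover have "F n = r F n / c" using F[of n] False unfolding G_def by metis
        ultimately show ?thesis using c by (metis nonzero_mult_div_cancel_left)
      qed
    qed
    then show "f = F" by auto
  qed
qed

lemma S_star_nonpos: "0 < \<mu> \<Longrightarrow> S_star \<beta> \<mu> \<tau> h \<sigma> \<le> 0"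
  by (simp add: S_star_def)

lemma amplitude_sequence_ex1:
  assumes "0 < \<mu>"
  shows "\<exists>!\<rho>. amplitude_sequence \<beta> \<mu> \<tau> h \<sigma> \<rho>0 d0 \<rho>"
proof -
  define S where "S = S_star \<beta> \<mu> \<tau> h \<sigma>"
  define c :: complex where "c = of_real (1 - S * 2 powr (-\<beta>))"
  have "S * 2 powr (-\<beta>) \<le> 0"
    using S_star_nonpos[OF assms] by (simp add: S_def mult_nonpos_nonneg)
  then have c0: "c \<noteq> 0" unfolding c_def of_real_eq_0_iff by linarith
  define r :: "(nat \<Rightarrow> complex) \<Rightarrow> nat \<Rightarrow> complex" where
    "r \<rho> n = \<rho> 0 + d0 * of_real (real n * \<tau>)
       - (\<Sum>k<n. of_real (alpha \<beta> (n - k)) * (\<rho> k - \<rho> 0 - d0 * of_real (real k * \<tau>)))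
       + of_real S * ((\<Sum>k<n. of_real (theta \<beta> (n - k)) * \<rho> k)
          + of_real (A_coeff \<beta> n) * \<rho> 0 + of_real (B_coeff \<beta> n) * d0 * of_real \<tau>)" for \<rho> n
  define r' where "r' \<rho> n = (if n = 0 then 0 else r \<rho> n)" for \<rho> n
  have eq: "amplitude_equation \<beta> \<mu> \<tau> h \<sigma> d0 \<rho> n \<longleftrightarrow> c * \<rho> n = r' \<rho> n" if "n \<ge> 1" for \<rho> n
  proof -
    have split: "(\<Sum>k\<le>n. g k) = (\<Sum>k<n. g k) + g n" for g :: "nat \<Rightarrow> complex"
      by (simp flip: lessThan_Suc_atMost)
    define X where "X = (\<Sum>k<n. of_real (alpha \<beta> (n - k)) * (\<rho> k - \<rho> 0 - d0 * of_real (real k * \<tau>)))"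
    define Y where "Y = (\<Sum>k<n. of_real (theta \<beta> (n - k)) * \<rho> k)"
    define Z where "Z = of_real (A_coeff \<beta> n) * \<rho> 0 + of_real (B_coeff \<beta> n) * d0 * complex_of_real \<tau>"
    have c_eq: "c = 1 - of_real S * of_real (theta \<beta> 0)"
      by (simp add: c_def theta_def alpha_def)
    have a0: "complex_of_real (alpha \<beta> 0) = 1" by (simp add: alpha_def)
    have "amplitude_equation \<beta> \<mu> \<tau> h \<sigma> d0 \<rho> n \<longleftrightarrow>
        X + (\<rho> n - \<rho> 0 - d0 * of_real (real n * \<tau>)) = of_real S * (Y + of_real (theta \<beta> 0) * \<rho> n + Z)"
      unfolding amplitude_equation_def S_def[symmetric] split X_def[symmetric] Y_def[symmetric]
      by (simp only: diff_self_eq_0 a0 mult_1 Z_def add.assoc)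
    also have "\<dots> \<longleftrightarrow> c * \<rho> n = r \<rho> n"
      unfolding r_def X_def[symmetric] Y_def[symmetric] add.assoc Z_def[symmetric] c_eq
      by algebra
    finally show ?thesis using that by (simp add: r'_def)
  qed
  have "\<exists>!\<rho>. \<rho> 0 = \<rho>0 \<and> (\<forall>n\<ge>1. c * \<rho> n = r' \<rho> n)"
    by (rule triangular_recursion[OF c0]) (auto simp: r'_def r_def)
  then show ?thesis by (simp add: amplitude_sequence_def eq)
qed


section \<open>The amplitude equation arises from the interior equation\<close>

lemma second_diff_fourier_mode:
  "second_diff h (\<lambda>j. z * fourier_mode \<sigma> h j) j
   = of_real (- 4 / h\<^sup>2 * (sin (\<sigma> * h / 2))\<^sup>2) * (z * fourier_mode \<sigma> h j)"
proof -
  define w where "w = \<sigma> * h"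
  have p: "fourier_mode \<sigma> h (j + 1) = fourier_mode \<sigma> h j * cis w"
    by (simp add: fourier_mode_def w_def cis_conv_exp exp_add[symmetric] algebra_simps)
  have m: "fourier_mode \<sigma> h (j - 1) = fourier_mode \<sigma> h j * cis (- w)"
    by (simp add: fourier_mode_def w_def cis_conv_exp exp_add[symmetric] algebra_simps)
  have "cos w = 1 - 2 * (sin (w / 2))\<^sup>2"
    using cos_double_sin[of "w / 2"] by simp
  then have cis: "cis w + cis (- w) - 2 = of_real (- 4 * (sin (w / 2))\<^sup>2)"
    by (simp add: complex_eq_iff)
  have "second_diff h (\<lambda>j. z * fourier_mode \<sigma> h j) j
      = of_real (1 / h\<^sup>2) * ((cis w + cis (- w) - 2) * (z * fourier_mode \<sigma> h j))"
    unfolding second_diff_def p m by (simp add: scaleR_conv_of_real algebra_simps)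
  also have "\<dots> = of_real (- 4 / h\<^sup>2 * (sin (\<sigma> * h / 2))\<^sup>2) * (z * fourier_mode \<sigma> h j)"
    unfolding cis by (simp add: w_def)
  finally show ?thesis .
qed

lemma interior_equation_fourier_mode:
  fixes \<phi>0 \<psi>0 :: "real \<Rightarrow> complex"
  assumes \<tau>: "0 < \<tau>"
    and \<phi>0: "\<And>j. \<phi>0 (grid_point a h j) = \<rho> 0 * fourier_mode \<sigma> h j"
    and \<psi>0: "\<And>j. \<psi>0 (grid_point a h j) = d0 * fourier_mode \<sigma> h j"
  shows "interior_equation \<beta> \<mu> \<tau> h a \<phi>0 \<psi>0 (\<lambda>k j. 0) (\<lambda>k j. \<rho> k * fourier_mode \<sigma> h j) n j
         \<longleftrightarrow> amplitude_equation \<beta> \<mu> \<tau> h \<sigma> d0 \<rho> n"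
proof -
  define E where "E = fourier_mode \<sigma> h j"
  have E0: "E \<noteq> 0" by (simp add: E_def fourier_mode_def)
  define q where "q = - 4 / h\<^sup>2 * (sin (\<sigma> * h / 2))\<^sup>2"
  define S where "S = S_star \<beta> \<mu> \<tau> h \<sigma>"
  have S: "S = \<mu> * \<tau> powr \<beta> * q" by (simp add: S_def S_star_def q_def)
  define p where "p k = \<rho> 0 + d0 * of_real (real k * \<tau>)" for k
  define P where "P k = \<rho> 0 * of_real (real k powr \<beta> / Gamma (\<beta> + 1))
      + d0 * of_real (\<tau> * (real k powr (\<beta> + 1) / Gamma (\<beta> + 2)))" for k
  have phi: "phi_term \<tau> h a \<phi>0 \<psi>0 k = (\<lambda>j. p k * fourier_mode \<sigma> h j)" for k
    by (rule ext) (simp add: phi_term_def \<phi>0 \<psi>0 p_def scaleR_conv_of_real algebra_simps)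
  have pw: "(real k * \<tau>) powr \<beta> = \<tau> powr \<beta> * real k powr \<beta>"
    "(real k * \<tau>) powr (\<beta> + 1) = \<tau> powr \<beta> * (\<tau> * real k powr (\<beta> + 1))" for k
    using \<tau> by (simp_all add: powr_mult powr_add)
  have Phi: "Phi_term \<beta> \<tau> h a \<phi>0 \<psi>0 k
      = (\<lambda>j. (of_real (\<tau> powr \<beta>) * P k) * fourier_mode \<sigma> h j)" for k
    by (rule ext) (simp only: Phi_term_def \<phi>0 \<psi>0 P_def pw, simp add: scaleR_conv_of_real algebra_simps)
  have sd: "second_diff h (\<lambda>j. z * fourier_mode \<sigma> h j) j = of_real q * (z * E)" for z
    unfolding E_def q_def by (rule second_diff_fourier_mode)
  define L where "L = (\<Sum>k\<le>n. of_real (alpha \<beta> (n - k)) * (\<rho> k - p k))"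
  define M where "M = (\<Sum>k\<le>n. of_real (theta \<beta> (n - k)) * (\<rho> k - p k))"
  define R where "R = (\<Sum>k\<le>n. of_real (alpha \<beta> (n - k)) * P k)"
  have 1: "(\<Sum>k\<le>n. alpha \<beta> (n - k) *\<^sub>R (\<rho> k * E - p k * E)) = L * E"
    unfolding L_def sum_distrib_right
    by (rule sum.cong) (simp_all add: scaleR_conv_of_real algebra_simps)
  have 2: "(\<Sum>k\<le>n. theta \<beta> (n - k) *\<^sub>R (of_real q * (\<rho> k * E) - of_real q * (p k * E)))
      = of_real q * M * E"
    unfolding M_def sum_distrib_right sum_distrib_left
    by (rule sum.cong) (simp_all add: scaleR_conv_of_real algebra_simps)
  have 3: "(\<Sum>k\<le>n. alpha \<beta> (n - k) *\<^sub>R (of_real q * (of_real (\<tau> powr \<beta>) * P k * E)))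
      = of_real q * of_real (\<tau> powr \<beta>) * R * E"
    by (simp add: R_def sum_distrib_right sum_distrib_left scaleR_conv_of_real mult_ac)
  have "interior_equation \<beta> \<mu> \<tau> h a \<phi>0 \<psi>0 (\<lambda>k j. 0) (\<lambda>k j. \<rho> k * fourier_mode \<sigma> h j) n j
      \<longleftrightarrow> L * E = (\<mu> * \<tau> powr \<beta>) *\<^sub>R (of_real q * M * E)
           + \<mu> *\<^sub>R (of_real q * of_real (\<tau> powr \<beta>) * R * E)"
    unfolding interior_equation_def phi Phi sd E_def[symmetric] 1 2 3 by simp
  also have "\<dots> \<longleftrightarrow> L * E = (of_real S * (M + R)) * E"
    by (simp add: S scaleR_conv_of_real algebra_simps)
  also have "\<dots> \<longleftrightarrow> L = of_real S * (M + R)" using E0 by simp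
  also have "M + R = (\<Sum>k\<le>n. of_real (theta \<beta> (n - k)) * \<rho> k)
          + of_real (A_coeff \<beta> n) * \<rho> 0 + of_real (B_coeff \<beta> n) * d0 * of_real \<tau>"
    by (simp add: M_def R_def p_def P_def A_coeff_def B_coeff_def sum.distrib sum_subtractf
        sum_distrib_left sum_distrib_right algebra_simps)
  also have "L = (\<Sum>k\<le>n. of_real (alpha \<beta> (n - k)) * (\<rho> k - \<rho> 0 - d0 * of_real (real k * \<tau>)))"
    by (simp add: L_def p_def diff_diff_eq)
  finally show ?thesis by (simp only: amplitude_equation_def S_def)
qed

end

theory Submission
  imports Defs "HOL-Complex_Analysis.Complex_Analysis" "HOL-Real_Asymp.Real_Asymp"
begin

text \<open>
  In terms of generating functions the amplitude equation says \<open>Q(z) \<rho>(z) = r(z)\<close>, where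
  \<open>Q(z) = (1 - z)\<^sup>\<beta> - S\<^sup>* ((1 + z)/2)\<^sup>\<beta>\<close> and the coefficients of \<open>r\<close> are linear in the data
  \<open>\<rho>\<^sup>0\<close> and \<open>d\<^sub>0\<close>. When \<open>S\<^sup>* < 0\<close> the amplitudes are bounded because the coefficients of \<open>r\<close> are
  bounded and those of \<open>1/Q\<close> are absolutely summable (\<open>norm_fps_mult_nth_le\<close>).

  The right-hand side is bounded because the starting corrections \<open>A\<^sub>n\<close> and \<open>B\<^sub>n\<close> are differences
  of two quadratures of the same order. The sum of \<open>\<alpha>\<^sub>n\<^sub>-\<^sub>k k\<^sup>\<beta>\<^sup>+\<^sup>1\<close> is the fractional difference of
  order \<open>\<beta>\<close> of \<open>w\<^sub>k = k\<^sup>\<beta>\<^sup>+\<^sup>1\<close>. Factor \<open>(1 - z)\<^sup>\<beta> = (1 - z)\<^sup>\<beta>\<^sup>-\<^sup>2 (1 - z)\<^sup>2\<close>. Up to the factor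
  \<open>\<Gamma>(\<beta> + 2)\<close>, the ordinary second difference of \<open>w\<close> agrees with the coefficients of
  \<open>(1 - z)\<^sup>-\<^sup>\<beta>\<close> up to an error that is dominated by the coefficients of \<open>(1 - z)\<^sup>1\<^sup>-\<^sup>\<beta>\<close>. All
  coefficients of \<open>(1 - z)\<^sup>\<beta>\<^sup>-\<^sup>2\<close> are positive, so multiplying by this series preserves
  the domination: the main term becomes \<open>(1 - z)\<^sup>-\<^sup>2\<close>, whose coefficients are \<open>n + 1\<close>, and the error
  is dominated by \<open>(1 - z)\<^sup>-\<^sup>1\<close>, whose coefficients are all 1. Since the \<open>\<theta>\<^sub>k\<close> sum to 1 and have
  a finite first absolute moment, the sum of \<open>\<theta>\<^sub>n\<^sub>-\<^sub>k k\<close> is \<open>n + O(1)\<close> as well, and the linear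
  growth cancels in \<open>B\<^sub>n\<close>. For \<open>A\<^sub>n\<close> both parts are separately bounded.

  The summability of \<open>1/Q\<close> is where \<open>\<beta> < 2\<close> and the sign of \<open>S\<^sup>*\<close> enter. For \<open>|z| < 1\<close> the
  quotient \<open>(1 - z)/(1 + z)\<close> has positive real part, so the arguments of \<open>(1 - z)\<^sup>\<beta>\<close> and
  \<open>(1 + z)\<^sup>\<beta>\<close> differ by less than \<open>\<beta>\<pi>/2 < \<pi>\<close>. The two positively weighted terms of \<open>Q\<close> therefore
  cannot cancel, and \<open>|Q|\<close> is bounded below on the whole disc (\<open>norm_stability_symbol_ge\<close>). The
  only singularities of \<open>1/Q\<close> on the unit circle are the branch points \<open>\<plusminus>1\<close>, where
  \<open>(1/Q)'' = O((1 - |z|)\<^sup>\<beta>\<^sup>-\<^sup>2)\<close>. Cauchy's inequality on a circle of radius about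
  \<open>1 - 1/n\<close> then bounds the coefficients of \<open>1/Q\<close> by a multiple of \<open>n\<^sup>-\<^sup>\<beta>\<close>, which is summable
  because \<open>\<beta> > 1\<close>.

  In the degenerate case \<open>S\<^sup>* = 0\<close> the equation leaves only \<open>\<rho>\<^sup>n = \<rho>\<^sup>0 + n\<tau> d\<^sub>0\<close>, which on
  \<open>n\<tau> \<le> T\<close> is bounded by \<open>|\<rho>\<^sup>0| + |d\<^sub>0| T\<close>.
\<close>

section \<open>Coefficients of powers of 1 - z\<close>

(* The notation $ for vector components clashes with the one for power series coefficients. *)
unbundle no vec_syntax

text \<open>
  The binomial series of \<open>(1 - z)\<^sup>a\<close>. Positive \<open>a\<close> means differencing of order \<open>a\<close>, negative
  \<open>a\<close> means summation.
\<close>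

definition diff_fps :: "real \<Rightarrow> real fps" where
  "diff_fps a = Abs_fps (alpha a)"

lemma diff_fps_nth [simp]: "diff_fps a $ n = alpha a n"
  by (simp add: diff_fps_def)

lemma alpha_0 [simp]: "alpha a 0 = 1"
  by (simp add: alpha_def)

lemma alpha_Suc: "alpha a (Suc k) = alpha a k * ((real k - a) / (real k + 1))"
proof -
  have "of_nat (Suc k) * (a gchoose Suc k) = (a - real k) * (a gchoose k)"
    by (metis gbinomial_absorb_comp gbinomial_absorption)
  then have "a gchoose Suc k = (a - real k) * (a gchoose k) / (real k + 1)"
    by (simp add: field_simps)
  then show ?thesis
    by (simp add: alpha_def minus_divide_left algebra_simps)
qed

lemma diff_fps_mult: "diff_fps a * diff_fps b = diff_fps (a + b)"
proof (rule fps_ext)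
  fix n
  have "(diff_fps a * diff_fps b) $ n = (\<Sum>k=0..n. (-1) ^ n * ((a gchoose k) * (b gchoose (n - k))))"
    unfolding fps_mult_nth
  proof (intro sum.cong refl)
    fix k assume "k \<in> {0..n}"
    then have "(-1) ^ k * (-1) ^ (n - k) = (-1 :: real) ^ n"
      by (simp flip: power_add)
    then show "diff_fps a $ k * diff_fps b $ (n - k) = (-1) ^ n * ((a gchoose k) * (b gchoose (n - k)))"
      by (simp add: alpha_def mult_ac)
  qed
  also have "\<dots> = diff_fps (a + b) $ n"
    by (simp add: alpha_def gbinomial_Vandermonde flip: sum_distrib_left)
  finally show "(diff_fps a * diff_fps b) $ n = diff_fps (a + b) $ n" .
qed

lemma alpha_minus_one [simp]: "alpha (-1) n = 1"
  by (induction n) (simp_all add: alpha_Suc)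

lemma alpha_minus_two [simp]: "alpha (-2) n = real n + 1"
  by (induction n) (simp_all add: alpha_Suc field_simps)

lemma diff_fps_two: "diff_fps 2 = 1 - 2 * fps_X + fps_X ^ 2"
proof (rule fps_ext)
  fix n
  have "alpha 2 (k + 3) = 0" for k
    by (induction k) (simp_all add: alpha_Suc numeral_3_eq_3)
  then have "alpha 2 n = 0" if "n \<ge> 3" for n
    using that by (metis le_add_diff_inverse2)
  moreover have "alpha 2 1 = -2" "alpha 2 2 = 1"
    by (simp_all add: alpha_Suc numeral_2_eq_2)
  ultimately show "diff_fps 2 $ n = (1 - 2 * fps_X + fps_X ^ 2) $ n"
    by (cases "n < 3") (auto simp: less_Suc_eq numeral_3_eq_3 numeral_2_eq_2 fps_X_power_iff fps_mult_nth_0 fps_numeral_nth)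
qed

lemma convolution_eq: "(\<Sum>k\<le>n. alpha \<beta> (n - k) * w k) = (diff_fps \<beta> * Abs_fps w) $ n"
  by (subst mult.commute) (simp add: fps_mult_nth atLeast0AtMost mult.commute)

lemma convolution_flip:
  fixes f g :: "nat \<Rightarrow> real"
  shows "(\<Sum>k\<le>n. f (n - k) * g k) = (\<Sum>k\<le>n. f k * g (n - k))"
proof -
  have "(\<Sum>k\<le>n. f (n - k) * g k) = (\<Sum>k\<le>n. f (n - k) * g (n - (n - k)))"
    by (rule sum.cong) simp_all
  also have "\<dots> = (\<Sum>k\<le>n. f k * g (n - k))"
    using sum.nat_diff_reindex[of "\<lambda>k. f k * g (n - k)" "Suc n"]
    by (simp only: lessThan_Suc_atMost diff_Suc_Suc)
  finally show ?thesis .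
qed

lemma sum_alpha: "(\<Sum>k\<le>n. alpha a k) = alpha (a - 1) n"
proof -
  have "(\<Sum>k\<le>n. alpha a k) = (diff_fps a * diff_fps (-1)) $ n"
    by (simp add: fps_mult_nth atLeast0AtMost)
  then show ?thesis
    by (simp add: diff_fps_mult)
qed

lemma alpha_pos: "a < 0 \<Longrightarrow> alpha a n > 0"
  by (induction n) (simp_all add: alpha_Suc)

lemma alpha_le_one:
  assumes "-1 \<le> a" "a \<le> 0"
  shows "alpha a n \<le> 1" "alpha a n \<ge> 0"
proof -
  have "0 \<le> alpha a n \<and> alpha a n \<le> 1"
  proof (induction n)
    case (Suc n)
    have "(real n - a) / (real n + 1) \<in> {0..1}"
      using assms by (simp add: divide_simps)
    with Suc show ?case
      unfolding alpha_Suc atLeastAtMost_iff by (meson mult_le_one mult_nonneg_nonneg)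
  qed simp
  then show "alpha a n \<le> 1" "alpha a n \<ge> 0" by auto
qed

lemma alpha_Suc_nonpos:
  assumes "0 < p" "p < 1"
  shows "alpha p (Suc n) \<le> 0"
proof (induction n)
  case 0
  then show ?case using assms by (simp add: alpha_Suc)
next
  case (Suc n)
  have "(real (Suc n) - p) / (real (Suc n) + 1) \<ge> 0"
    using assms by simp
  with Suc show ?case
    by (subst alpha_Suc) (rule mult_nonpos_nonneg)
qed

text \<open>
  Only the leading coefficient of \<open>(1 - z)\<^sup>p\<close> is positive, so the absolute sum is 2 minus the
  signed sum, and the signed sum is a coefficient of \<open>(1 - z)\<^sup>p\<^sup>-\<^sup>1\<close>, hence nonnegative.
\<close>

lemma sum_abs_alpha_le:
  assumes "0 < p" "p < 1"
  shows "(\<Sum>k\<le>n. \<bar>alpha p k\<bar>) \<le> 2"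
proof -
  have "\<bar>alpha p k\<bar> = (if k = 0 then 2 else 0) - alpha p k" for k
    using alpha_Suc_nonpos[OF assms] by (cases k) auto
  then have "(\<Sum>k\<le>n. \<bar>alpha p k\<bar>) = 2 - alpha (p - 1) n"
    by (simp add: sum_subtractf sum_alpha)
  also have "\<dots> \<le> 2"
    using alpha_le_one[of "p - 1" n] assms by simp
  finally show ?thesis .
qed

text \<open>
  Differentiation of \<open>(1 - z)\<^sup>\<beta>\<close> lowers the exponent into the range of
  \<open>sum_abs_alpha_le\<close>.
\<close>

lemma sum_index_abs_alpha_le:
  assumes "1 < \<beta>" "\<beta> < 2"
  shows "(\<Sum>k\<le>n. real k * \<bar>alpha \<beta> k\<bar>) \<le> 2 * \<beta>"
proof (cases n)
  case (Suc m)
  have *: "real (Suc k) * \<bar>alpha \<beta> (Suc k)\<bar> = \<beta> * \<bar>alpha (\<beta> - 1) k\<bar>" for k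
  proof -
    have "real (Suc k) * (\<beta> gchoose Suc k) = \<beta> * ((\<beta> - 1) gchoose k)"
      by (rule gbinomial_absorption)
    then have "\<bar>real (Suc k) * (\<beta> gchoose Suc k)\<bar> = \<bar>\<beta> * ((\<beta> - 1) gchoose k)\<bar>"
      by simp
    then show ?thesis
      using assms by (simp add: alpha_def abs_mult power_abs)
  qed
  have "(\<Sum>k\<le>n. real k * \<bar>alpha \<beta> k\<bar>) = (\<Sum>k\<le>m. \<beta> * \<bar>alpha (\<beta> - 1) k\<bar>)"
    unfolding Suc by (subst sum.atMost_Suc_shift) (simp only: * of_nat_0 mult_zero_left add_0)
  also have "\<dots> = \<beta> * (\<Sum>k\<le>m. \<bar>alpha (\<beta> - 1) k\<bar>)"
    by (simp add: sum_distrib_left)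
  also have "\<dots> \<le> \<beta> * 2"
    using assms by (intro mult_left_mono sum_abs_alpha_le) auto
  finally show ?thesis by simp
qed (use assms in simp)

section \<open>Growth of the coefficients of negative powers\<close>

lemma powr_one_plus_le:
  fixes x p :: real
  assumes "0 \<le> p" "p \<le> 1" "x > -1"
  shows "(1 + x) powr p \<le> 1 + p * x"
  using Youngs_inequality_0[of p "1 - p" "1 + x" 1] assms by (simp add: algebra_simps)

text \<open>
  The ratio of consecutive coefficients of \<open>(1 - z)\<^sup>-\<^sup>p\<close> dominates that of \<open>n\<^sup>p\<^sup>-\<^sup>1\<close>, by Bernoulli's
  inequality with exponent \<open>1 - p\<close>.
\<close>

lemma powr_le_alpha_neg:
  assumes "0 < p" "p < 1" "n \<ge> 1"
  shows "p * real n powr (p - 1) \<le> alpha (-p) n"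
  using assms(3)
proof (induction n rule: dec_induct)
  case base
  then show ?case by (simp add: alpha_Suc)
next
  case (step n)
  have "(real n / (real n + 1)) powr (1 - p) = (1 + (-1 / (real n + 1))) powr (1 - p)"
    by (simp add: field_simps)
  also have "\<dots> \<le> 1 + (1 - p) * (-1 / (real n + 1))"
    using assms step by (intro powr_one_plus_le) (auto simp: field_simps)
  also have "\<dots> = (real n + p) / (real n + 1)"
    by (simp add: field_simps)
  finally have *: "(real n / (real n + 1)) powr (1 - p) \<le> (real n + p) / (real n + 1)" .
  have "(real n + 1) powr (p - 1) = real n powr (p - 1) * (real n / (real n + 1)) powr (1 - p)"
    using step powr_minus_divide[of "real n" "1 - p"] powr_minus_divide[of "real n + 1" "1 - p"]
    by (simp add: powr_divide)
  also have "\<dots> \<le> real n powr (p - 1) * ((real n + p) / (real n + 1))"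
    by (intro mult_left_mono *) auto
  finally have **: "(real n + 1) powr (p - 1) \<le> real n powr (p - 1) * ((real n + p) / (real n + 1))" .
  have "p * (real n + 1) powr (p - 1) \<le> p * real n powr (p - 1) * ((real n + p) / (real n + 1))"
    using mult_left_mono[OF **, of p] assms by (simp only: mult.assoc)
  also have "\<dots> \<le> alpha (-p) n * ((real n + p) / (real n + 1))"
    using step assms by (intro mult_right_mono) auto
  finally show ?case by (simp add: alpha_Suc add_ac)
qed

text \<open>
  Log-convexity of \<open>\<Gamma>\<close> between \<open>x\<close> and \<open>x + 1\<close>.
\<close>

lemma Gamma_add_le_powr:
  fixes x p :: real
  assumes "x > 0" "0 \<le> p" "p \<le> 1"
  shows "Gamma (x + p) \<le> Gamma x * x powr p"
proof -
  have "(ln \<circ> Gamma) ((1 - p) *\<^sub>R x + p *\<^sub>R (x + 1)) \<le> (1 - p) * (ln \<circ> Gamma) x + p * (ln \<circ> Gamma) (x + 1 :: real)"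
    using assms by (intro convex_onD[OF log_convex_Gamma_real]) auto
  moreover have "(1 - p) *\<^sub>R x + p *\<^sub>R (x + 1) = x + p"
    by (simp add: algebra_simps)
  moreover have "x \<notin> \<int>\<^sub>\<le>\<^sub>0"
    using assms by (auto elim!: nonpos_Ints_cases)
  then have "Gamma (x + 1) = x * Gamma x"
    by (rule Gamma_plus1)
  moreover have "Gamma x \<noteq> 0"
    using assms Gamma_real_pos[of x] by linarith
  ultimately have "ln (Gamma (x + p)) \<le> ln (Gamma x) + p * ln x"
    using assms by (simp add: ln_mult algebra_simps)
  also have "\<dots> = ln (Gamma x * x powr p)"
    using assms \<open>Gamma x \<noteq> 0\<close> by (simp add: ln_mult ln_powr)
  finally show ?thesis
    using assms by (subst (asm) ln_le_cancel_iff) (auto intro!: Gamma_real_pos mult_pos_pos)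
qed

lemma alpha_neg_Gamma:
  assumes "a > 0"
  shows "alpha (-a) n = Gamma (real n + a) / (Gamma a * Gamma (real n + 1))"
proof (induction n)
  case 0
  show ?case using assms by (simp add: Gamma_real_pos less_imp_neq[OF Gamma_real_pos, symmetric])
next
  case (Suc n)
  have "real n + a \<notin> \<int>\<^sub>\<le>\<^sub>0" "real n + 1 \<notin> \<int>\<^sub>\<le>\<^sub>0"
    using assms by (auto elim!: nonpos_Ints_cases)
  then have "Gamma (real n + a + 1) = (real n + a) * Gamma (real n + a)"
    "Gamma (real n + 1 + 1) = (real n + 1) * Gamma (real n + 1)"
    by (blast intro: Gamma_plus1)+
  with Suc show ?case
    by (simp add: alpha_Suc add_ac mult_ac)
qed

text \<open>
  Both bounds are instances of the log-convexity inequality for the ratio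
  \<open>\<Gamma>(n + \<beta>) / \<Gamma>(n + 1)\<close>. They fix the leading constant \<open>1/\<Gamma>(\<beta>)\<close> exactly and leave a relative
  error of order \<open>1/n\<close>; the cancellation in \<open>B\<^sub>n\<close> needs both.
\<close>

lemma alpha_neg_bounds:
  assumes "1 < \<beta>" "\<beta> < 2" "n \<ge> 1"
  shows "real n powr (\<beta> - 1) \<le> Gamma \<beta> * alpha (-\<beta>) n"
    and "Gamma \<beta> * alpha (-\<beta>) n \<le> (real n + 1) powr (\<beta> - 1)"
proof -
  have pos: "Gamma \<beta> > 0" "Gamma (real n + 1) > 0" "Gamma (real n + \<beta>) > 0"
    using assms by (auto intro!: Gamma_real_pos)
  have eq: "Gamma \<beta> * alpha (-\<beta>) n = Gamma (real n + \<beta>) / Gamma (real n + 1)"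
    using assms pos by (simp add: alpha_neg_Gamma del: Gamma_real_pos)
  have "Gamma (real n + \<beta>) \<le> Gamma (real n + 1) * (real n + 1) powr (\<beta> - 1)"
    using Gamma_add_le_powr[of "real n + 1" "\<beta> - 1"] assms by simp
  then show "Gamma \<beta> * alpha (-\<beta>) n \<le> (real n + 1) powr (\<beta> - 1)"
    unfolding eq using pos by (simp add: divide_le_eq mult.commute)
  \<comment> \<open>For the lower bound the step from \<open>n + \<beta> - 1\<close> to \<open>n + 1\<close> has length \<open>2 - \<beta> \<le> 1\<close>.\<close>
  have nz: "real n + (\<beta> - 1) \<notin> \<int>\<^sub>\<le>\<^sub>0"
    using assms by (auto elim!: nonpos_Ints_cases)
  have "Gamma (real n + (\<beta> - 1) + (1 - (\<beta> - 1))) \<le> Gamma (real n + (\<beta> - 1)) * (real n + (\<beta> - 1)) powr (1 - (\<beta> - 1))"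
    using assms by (intro Gamma_add_le_powr) auto
  then have "Gamma (real n + 1) \<le> Gamma (real n + (\<beta> - 1)) * (real n + (\<beta> - 1)) powr (2 - \<beta>)"
    by (simp add: add_ac)
  then have "Gamma (real n + 1) * (real n + (\<beta> - 1)) powr (\<beta> - 1) \<le> Gamma (real n + (\<beta> - 1)) * (real n + (\<beta> - 1)) powr (2 - \<beta>) * (real n + (\<beta> - 1)) powr (\<beta> - 1)"
    by (intro mult_right_mono) auto
  also have "\<dots> = Gamma (real n + (\<beta> - 1)) * (real n + (\<beta> - 1))"
    using assms by (simp add: mult.assoc flip: powr_add)
  also have "\<dots> = Gamma (real n + \<beta>)"
    using Gamma_plus1[OF nz] by (simp add: add_ac mult_ac)
  finally have "Gamma (real n + 1) * (real n + (\<beta> - 1)) powr (\<beta> - 1) \<le> Gamma (real n + \<beta>)" .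
  moreover have "real n powr (\<beta> - 1) \<le> (real n + (\<beta> - 1)) powr (\<beta> - 1)"
    using assms by (intro powr_mono2) auto
  then have "Gamma (real n + 1) * real n powr (\<beta> - 1) \<le> Gamma (real n + 1) * (real n + (\<beta> - 1)) powr (\<beta> - 1)"
    using pos by (intro mult_left_mono) auto
  ultimately have "Gamma (real n + 1) * real n powr (\<beta> - 1) \<le> Gamma (real n + \<beta>)"
    by linarith
  then show "real n powr (\<beta> - 1) \<le> Gamma \<beta> * alpha (-\<beta>) n"
    unfolding eq using pos by (simp add: le_divide_eq mult.commute)
qed

text \<open>
  Convolutions see all indices, so eventual bounds are first turned into bounds at every index;
  positivity of the comparison sequence absorbs the finitely many exceptions.
\<close>

lemma bigo_imp_le_everywhere:
  fixes f g :: "nat \<Rightarrow> real"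
  assumes "f \<in> O(g)" "\<And>n. g n > 0"
  obtains C where "C \<ge> 0" "\<And>n. \<bar>f n\<bar> \<le> C * g n"
proof -
  from assms(1) obtain c where c: "c > 0" "eventually (\<lambda>n. norm (f n) \<le> c * norm (g n)) sequentially"
    by (rule landau_o.bigE)
  then obtain N where N: "\<And>n. n \<ge> N \<Longrightarrow> \<bar>f n\<bar> \<le> c * \<bar>g n\<bar>"
    by (auto simp: eventually_sequentially)
  define C where "C = c + (\<Sum>k<N. \<bar>f k\<bar> / g k)"
  have nn: "\<bar>f k\<bar> / g k \<ge> 0" for k
    using assms(2)[of k] by simp
  have "\<bar>f n\<bar> \<le> C * g n" for n
  proof -
    have "\<bar>f n\<bar> / g n \<le> C"
    proof (cases "n < N")
      case True
      then have "\<bar>f n\<bar> / g n \<le> (\<Sum>k<N. \<bar>f k\<bar> / g k)"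
        by (intro member_le_sum) (use nn in auto)
      then show ?thesis using c by (simp add: C_def)
    next
      case False
      then have "\<bar>f n\<bar> / g n \<le> c"
        using N[of n] assms(2)[of n] by (simp add: divide_le_eq)
      moreover have "(\<Sum>k<N. \<bar>f k\<bar> / g k) \<ge> 0" by (intro sum_nonneg nn)
      ultimately show ?thesis by (simp add: C_def)
    qed
    then show ?thesis using assms(2)[of n] by (simp add: divide_le_eq)
  qed
  moreover have "C \<ge> 0"
    unfolding C_def using c by (intro add_nonneg_nonneg sum_nonneg nn) auto
  ultimately show ?thesis by (rule that[rotated])
qed

lemma powr_minus_two_bigo_alpha:
  assumes "1 < \<beta>" "\<beta> < 2"
  shows "(\<lambda>n. real n powr (\<beta> - 2)) \<in> O(\<lambda>n. alpha (1 - \<beta>) n)"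
proof (rule bigoI[where c = "1 / (\<beta> - 1)"])
  show "\<forall>\<^sub>F n in sequentially. norm (real n powr (\<beta> - 2)) \<le> 1 / (\<beta> - 1) * norm (alpha (1 - \<beta>) n)"
    using eventually_ge_at_top[of 1]
  proof eventually_elim
    case (elim n)
    have "(\<beta> - 1) * real n powr (\<beta> - 2) \<le> alpha (1 - \<beta>) n"
      using powr_le_alpha_neg[of "\<beta> - 1" n] assms elim by simp
    then show ?case
      using assms by (simp add: field_simps)
  qed
qed

section \<open>Fractional differences of power functions\<close>

lemma diff_fps_two_mult_nth:
  assumes "n \<ge> 2"
  shows "(diff_fps 2 * Abs_fps w) $ n = w n - 2 * w (n - 1) + w (n - 2)"
  using assms
  by (simp add: diff_fps_two distrib_right left_diff_distrib mult.assoc fps_mult_numeral_left fps_X_power_mult_nth)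

text \<open>
  The coefficients of \<open>(1 - z)\<^sup>a\<close> with \<open>a < 0\<close> are positive, so a bound on a sequence by those of
  \<open>(1 - z)\<^sup>c\<close> survives fractional summation, and the exponents add.
\<close>

lemma abs_diff_fps_mult_le:
  assumes "a < 0" "\<And>n. \<bar>x n\<bar> \<le> C * alpha c n"
  shows "\<bar>(diff_fps a * Abs_fps x) $ n\<bar> \<le> C * alpha (a + c) n"
proof -
  have "\<bar>(diff_fps a * Abs_fps x) $ n\<bar> \<le> (\<Sum>k=0..n. \<bar>alpha a k * x (n - k)\<bar>)"
    unfolding fps_mult_nth by (simp add: sum_abs)
  also have "\<dots> \<le> (\<Sum>k=0..n. alpha a k * (C * alpha c (n - k)))"
    using assms alpha_pos[OF assms(1)] by (intro sum_mono) (simp add: abs_mult less_imp_le mult_left_mono)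
  also have "\<dots> = C * (diff_fps a * diff_fps c) $ n"
    by (simp add: fps_mult_nth sum_distrib_left mult_ac)
  finally show ?thesis by (simp add: diff_fps_mult)
qed

text \<open>
  The second difference of \<open>k\<^sup>\<beta>\<close> is \<open>O(k\<^sup>\<beta>\<^sup>-\<^sup>2)\<close>, hence dominated by the coefficients of
  \<open>(1 - z)\<^sup>1\<^sup>-\<^sup>\<beta>\<close>. The remaining factor \<open>(1 - z)\<^sup>\<beta>\<^sup>-\<^sup>2\<close> of \<open>(1 - z)\<^sup>\<beta>\<close> turns this bound into a
  multiple of the coefficients of \<open>(1 - z)\<^sup>-\<^sup>1\<close>, which are constant.
\<close>

lemma alpha_conv_powr_bounded:
  assumes "1 < \<beta>" "\<beta> < 2"
  shows "\<exists>C. \<forall>n. \<bar>\<Sum>k\<le>n. alpha \<beta> (n - k) * real k powr \<beta>\<bar> \<le> C"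
proof -
  define w where "w k = real k powr \<beta>" for k
  define D where "D n = (diff_fps 2 * Abs_fps w) $ n" for n
  have "(\<lambda>n. real n powr \<beta> - 2 * (real n - 1) powr \<beta> + (real n - 2) powr \<beta>) \<in> O(\<lambda>n. real n powr (\<beta> - 2))"
    using assms by real_asymp
  moreover have "\<forall>\<^sub>F n in sequentially. D n = real n powr \<beta> - 2 * (real n - 1) powr \<beta> + (real n - 2) powr \<beta>"
    using eventually_ge_at_top[of 2]
    by eventually_elim (simp add: D_def diff_fps_two_mult_nth w_def of_nat_diff)
  ultimately have "D \<in> O(\<lambda>n. real n powr (\<beta> - 2))"
    by (simp cong: landau_o.big.in_cong)
  also note powr_minus_two_bigo_alpha[OF assms]
  finally obtain C where C: "\<And>n. \<bar>D n\<bar> \<le> C * alpha (1 - \<beta>) n"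
    using alpha_pos[of "1 - \<beta>"] assms by (elim bigo_imp_le_everywhere) auto
  have "\<bar>\<Sum>k\<le>n. alpha \<beta> (n - k) * real k powr \<beta>\<bar> \<le> C" for n
  proof -
    have "(\<Sum>k\<le>n. alpha \<beta> (n - k) * real k powr \<beta>) = (diff_fps \<beta> * Abs_fps w) $ n"
      unfolding convolution_eq w_def ..
    also have "diff_fps \<beta> * Abs_fps w = diff_fps (\<beta> - 2) * Abs_fps D"
      unfolding D_def fps_nth_inverse by (simp add: diff_fps_mult flip: mult.assoc)
    also have "\<bar>\<dots> $ n\<bar> \<le> C * alpha (\<beta> - 2 + (1 - \<beta>)) n"
      using assms C by (intro abs_diff_fps_mult_le) auto
    finally show ?thesis by simp
  qed
  then show ?thesis by blast
qed

text \<open>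
  Here the second difference of \<open>k\<^sup>\<beta>\<^sup>+\<^sup>1 / \<Gamma>(\<beta> + 2)\<close> is \<open>k\<^sup>\<beta>\<^sup>-\<^sup>1 / \<Gamma>(\<beta>) + O(k\<^sup>\<beta>\<^sup>-\<^sup>2)\<close>, and the main
  term may be replaced by the coefficient of \<open>(1 - z)\<^sup>-\<^sup>\<beta>\<close> at the cost of another \<open>O(k\<^sup>\<beta>\<^sup>-\<^sup>2)\<close>.
  This choice makes the main contribution to the convolution exactly
  \<open>(1 - z)\<^sup>\<beta>\<^sup>-\<^sup>2 (1 - z)\<^sup>-\<^sup>\<beta> = (1 - z)\<^sup>-\<^sup>2\<close>.
\<close>

lemma alpha_conv_powr_Suc_bounded:
  assumes "1 < \<beta>" "\<beta> < 2"
  shows "\<exists>C. \<forall>n. \<bar>(\<Sum>k\<le>n. alpha \<beta> (n - k) * real k powr (\<beta> + 1)) / Gamma (\<beta> + 2) - real n\<bar> \<le> C"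
proof -
  define w where "w k = real k powr (\<beta> + 1) / Gamma (\<beta> + 2)" for k
  define D where "D n = (diff_fps 2 * Abs_fps w) $ n" for n
  have G: "Gamma \<beta> > 0" using assms by (simp add: Gamma_real_pos)
  have nz: "\<beta> \<notin> \<int>\<^sub>\<le>\<^sub>0" "\<beta> + 1 \<notin> \<int>\<^sub>\<le>\<^sub>0"
    using assms by (auto elim!: nonpos_Ints_cases)
  have "Gamma (\<beta> + 2) = Gamma (\<beta> + 1 + 1)" by (simp add: add_ac)
  also have "\<dots> = (\<beta> + 1) * (\<beta> * Gamma \<beta>)"
    using Gamma_plus1[OF nz(1)] Gamma_plus1[OF nz(2)] by simp
  finally have G2: "Gamma (\<beta> + 2) = (\<beta> + 1) * (\<beta> * Gamma \<beta>)" .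
  have "(\<lambda>n. D n - real n powr (\<beta> - 1) / Gamma \<beta>) \<in> O(\<lambda>n. real n powr (\<beta> - 2))"
  proof -
    have bg: "(\<lambda>n. (1 / Gamma (\<beta> + 2)) * (real n powr (\<beta> + 1) - 2 * (real n - 1) powr (\<beta> + 1) + (real n - 2) powr (\<beta> + 1)
             - \<beta> * (\<beta> + 1) * real n powr (\<beta> - 1))) \<in> O(\<lambda>n. real n powr (\<beta> - 2))" (is "?f \<in> _")
    proof (subst landau_o.big.cmult_in_iff)
      show "1 / Gamma (\<beta> + 2) \<noteq> 0"
        using assms less_imp_neq[OF G] unfolding G2 by simp
      show "(\<lambda>n. real n powr (\<beta> + 1) - 2 * (real n - 1) powr (\<beta> + 1) + (real n - 2) powr (\<beta> + 1)
             - \<beta> * (\<beta> + 1) * real n powr (\<beta> - 1)) \<in> O(\<lambda>n. real n powr (\<beta> - 2))"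
        using assms by real_asymp
    qed
    have ev: "\<forall>\<^sub>F n in sequentially. D n - real n powr (\<beta> - 1) / Gamma \<beta> = ?f n"
      using eventually_ge_at_top[of 2]
    proof eventually_elim
      case (elim n)
      have "real n powr (\<beta> - 1) / Gamma \<beta> = (\<beta> * (\<beta> + 1) * real n powr (\<beta> - 1)) / Gamma (\<beta> + 2)"
        using assms by (simp add: G2)
      then show ?case using elim
        by (simp add: D_def diff_fps_two_mult_nth w_def of_nat_diff diff_divide_distrib add_divide_distrib)
    qed
    show ?thesis
      using landau_o.big.in_cong[OF ev] bg by (rule iffD2)
  qed
  moreover have "(\<lambda>n. real n powr (\<beta> - 1) / Gamma \<beta> - alpha (-\<beta>) n) \<in> O(\<lambda>n. real n powr (\<beta> - 2))"
  proof -
    have "(\<lambda>n. real n powr (\<beta> - 1) / Gamma \<beta> - alpha (-\<beta>) n) \<in> O(\<lambda>n. (real n + 1) powr (\<beta> - 1) - real n powr (\<beta> - 1))"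
    proof (rule bigoI[where c = "1 / Gamma \<beta>"])
      show "\<forall>\<^sub>F n in sequentially. norm (real n powr (\<beta> - 1) / Gamma \<beta> - alpha (-\<beta>) n)
          \<le> 1 / Gamma \<beta> * norm ((real n + 1) powr (\<beta> - 1) - real n powr (\<beta> - 1))"
        using eventually_ge_at_top[of 1]
      proof eventually_elim
        case (elim n)
        have "norm (real n powr (\<beta> - 1) / Gamma \<beta> - alpha (-\<beta>) n) = (Gamma \<beta> * alpha (-\<beta>) n - real n powr (\<beta> - 1)) / Gamma \<beta>"
          using alpha_neg_bounds[OF assms elim] G by (simp add: field_simps)
        also have "\<dots> \<le> ((real n + 1) powr (\<beta> - 1) - real n powr (\<beta> - 1)) / Gamma \<beta>"
          using alpha_neg_bounds[OF assms elim] G by (intro divide_right_mono) auto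
        also have "\<dots> \<le> 1 / Gamma \<beta> * norm ((real n + 1) powr (\<beta> - 1) - real n powr (\<beta> - 1))"
          using G by (simp add: divide_right_mono)
        finally show ?case .
      qed
    qed
    also have "(\<lambda>n. (real n + 1) powr (\<beta> - 1) - real n powr (\<beta> - 1)) \<in> O(\<lambda>n. real n powr (\<beta> - 2))"
      using assms by real_asymp
    finally show ?thesis .
  qed
  ultimately have "(\<lambda>n. (D n - real n powr (\<beta> - 1) / Gamma \<beta>) + (real n powr (\<beta> - 1) / Gamma \<beta> - alpha (-\<beta>) n)) \<in> O(\<lambda>n. real n powr (\<beta> - 2))"
    by (rule sum_in_bigo)
  then have "(\<lambda>n. D n - alpha (-\<beta>) n) \<in> O(\<lambda>n. real n powr (\<beta> - 2))"
    by simp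
  also note powr_minus_two_bigo_alpha[OF assms]
  finally obtain C where C: "\<And>n. \<bar>D n - alpha (-\<beta>) n\<bar> \<le> C * alpha (1 - \<beta>) n"
    using alpha_pos[of "1 - \<beta>"] assms by (elim bigo_imp_le_everywhere) auto
  have "\<bar>(\<Sum>k\<le>n. alpha \<beta> (n - k) * real k powr (\<beta> + 1)) / Gamma (\<beta> + 2) - real n\<bar> \<le> C + 1" for n
  proof -
    have "(\<Sum>k\<le>n. alpha \<beta> (n - k) * real k powr (\<beta> + 1)) / Gamma (\<beta> + 2) = (diff_fps \<beta> * Abs_fps w) $ n"
      unfolding convolution_eq[symmetric] w_def by (simp add: sum_divide_distrib)
    also have "diff_fps \<beta> * Abs_fps w = diff_fps (\<beta> - 2) * (diff_fps (-\<beta>) + Abs_fps (\<lambda>n. D n - alpha (-\<beta>) n))"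
    proof -
      have "diff_fps (-\<beta>) + Abs_fps (\<lambda>n. D n - alpha (-\<beta>) n) = diff_fps 2 * Abs_fps w"
        by (rule fps_ext) (simp add: D_def)
      then show ?thesis by (simp add: diff_fps_mult flip: mult.assoc)
    qed
    also have "\<dots> = diff_fps (-2) + diff_fps (\<beta> - 2) * Abs_fps (\<lambda>n. D n - alpha (-\<beta>) n)"
      by (simp add: distrib_left diff_fps_mult)
    finally have "(\<Sum>k\<le>n. alpha \<beta> (n - k) * real k powr (\<beta> + 1)) / Gamma (\<beta> + 2) - real n
        = 1 + (diff_fps (\<beta> - 2) * Abs_fps (\<lambda>n. D n - alpha (-\<beta>) n)) $ n"
      by simp
    moreover have "\<bar>(diff_fps (\<beta> - 2) * Abs_fps (\<lambda>n. D n - alpha (-\<beta>) n)) $ n\<bar> \<le> C * alpha (\<beta> - 2 + (1 - \<beta>)) n"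
      using assms C by (intro abs_diff_fps_mult_le) auto
    ultimately show ?thesis by simp
  qed
  then show ?thesis by blast
qed

section \<open>The quadrature weights on the second derivative\<close>

lemma abs_theta: "\<bar>theta \<beta> k\<bar> = 2 powr (-\<beta>) * \<bar>alpha \<beta> k\<bar>"
  by (simp add: theta_def abs_mult power_abs)

lemma theta_eq_gbinomial: "theta \<beta> k = 2 powr (-\<beta>) * (\<beta> gchoose k)"
proof -
  have "(-1) ^ k * (-1) ^ k = (1 :: real)"
    by (simp flip: power_mult_distrib)
  then show ?thesis
    by (simp add: theta_def alpha_def)
qed

lemma summable_index_abs_theta:
  assumes "1 < \<beta>" "\<beta> < 2"
  shows "summable (\<lambda>k. real k * \<bar>theta \<beta> k\<bar>)"
proof (rule summableI_nonneg_bounded)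
  fix n
  have "(\<Sum>k<n. real k * \<bar>theta \<beta> k\<bar>) \<le> (\<Sum>k\<le>n. real k * \<bar>theta \<beta> k\<bar>)"
    by (intro sum_mono2) auto
  also have "\<dots> = 2 powr (-\<beta>) * (\<Sum>k\<le>n. real k * \<bar>alpha \<beta> k\<bar>)"
    by (simp add: abs_theta sum_distrib_left mult_ac)
  also have "\<dots> \<le> 2 powr (-\<beta>) * (2 * \<beta>)"
    by (intro mult_left_mono sum_index_abs_alpha_le assms) auto
  finally show "(\<Sum>k<n. real k * \<bar>theta \<beta> k\<bar>) \<le> 2 powr (-\<beta>) * (2 * \<beta>)" .
qed auto

lemma summable_abs_theta:
  assumes "1 < \<beta>" "\<beta> < 2"
  shows "summable (\<lambda>k. \<bar>theta \<beta> k\<bar>)"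
proof (rule summable_comparison_test_ev[OF _ summable_index_abs_theta[OF assms]])
  show "\<forall>\<^sub>F k in sequentially. norm \<bar>theta \<beta> k\<bar> \<le> real k * \<bar>theta \<beta> k\<bar>"
    using eventually_ge_at_top[of 1]
    by eventually_elim (simp add: mult_le_cancel_right1)
qed

text \<open>
  The binomial series at the boundary point 1: absolute convergence makes its sum continuous on
  \<open>[0, 1]\<close>, so the identity on \<open>[0, 1)\<close> extends.
\<close>

lemma binomial_sums_two_powr:
  fixes \<beta> :: real
  assumes "summable (\<lambda>k. \<bar>\<beta> gchoose k\<bar>)"
  shows "(\<lambda>k. \<beta> gchoose k) sums 2 powr \<beta>"
proof -
  define F where "F x = (\<Sum>k. (\<beta> gchoose k) * x ^ k)" for x :: real
  have "uniform_limit {0..1} (\<lambda>n x. \<Sum>k<n. (\<beta> gchoose k) * x ^ k) F sequentially"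
    unfolding F_def using assms
    by (intro Weierstrass_m_test) (auto simp: abs_mult power_abs intro!: mult_left_le power_le_one)
  then have "continuous_on {0..1} F"
    by (rule uniform_limit_theorem[rotated]) (auto intro!: always_eventually continuous_intros)
  then have "(F \<longlongrightarrow> F 1) (at_left 1)"
    by (rule continuous_on_Icc_at_leftD) simp
  moreover have "((\<lambda>x :: real. (1 + x) powr \<beta>) \<longlongrightarrow> (1 + 1) powr \<beta>) (at_left 1)"
    by (intro tendsto_intros) auto
  moreover have "\<forall>\<^sub>F x in at_left 1. (1 + x) powr \<beta> = F x"
    using eventually_at_left_real[OF zero_less_one]
  proof eventually_elim
    case (elim x)
    then show ?case
      using gen_binomial_real[of x \<beta>] by (auto simp: F_def sums_iff)
  qed
  then have "((\<lambda>x. (1 + x) powr \<beta>) \<longlongrightarrow> F 1) (at_left 1) \<longleftrightarrow> (F \<longlongrightarrow> F 1) (at_left 1)"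
    by (rule tendsto_cong)
  ultimately have "F 1 = (1 + 1) powr \<beta>"
    using tendsto_unique[OF trivial_limit_at_left_real] by blast
  moreover have "summable (\<lambda>k. \<beta> gchoose k)"
    using assms by (rule summable_rabs_cancel)
  ultimately show ?thesis
    by (simp add: F_def sums_iff)
qed

lemma theta_sums_one:
  assumes "1 < \<beta>" "\<beta> < 2"
  shows "theta \<beta> sums 1"
proof -
  have "summable (\<lambda>k. 2 powr \<beta> * \<bar>theta \<beta> k\<bar>)"
    by (intro summable_mult summable_abs_theta assms)
  then have "summable (\<lambda>k. \<bar>\<beta> gchoose k\<bar>)"
    by (simp add: theta_eq_gbinomial abs_mult powr_minus)
  from sums_mult[OF binomial_sums_two_powr[OF this], of "2 powr (-\<beta>)"] show ?thesis
    by (simp add: theta_eq_gbinomial[abs_def] powr_minus)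
qed

lemma theta_sum_bounded:
  assumes "1 < \<beta>" "\<beta> < 2"
  shows "\<exists>C. \<forall>n. \<bar>\<Sum>k\<le>n. theta \<beta> (n - k)\<bar> \<le> C"
proof -
  have "\<bar>\<Sum>k\<le>n. theta \<beta> (n - k)\<bar> \<le> (\<Sum>k. \<bar>theta \<beta> k\<bar>)" for n
  proof -
    have "(\<Sum>k\<le>n. theta \<beta> (n - k)) = (\<Sum>k\<le>n. theta \<beta> k)"
      using convolution_flip[of "theta \<beta>" n "\<lambda>_. 1"] by simp
    also have "\<bar>\<dots>\<bar> \<le> (\<Sum>k\<le>n. \<bar>theta \<beta> k\<bar>)"
      by (rule sum_abs)
    also have "\<dots> \<le> (\<Sum>k. \<bar>theta \<beta> k\<bar>)"
      by (intro sum_le_suminf summable_abs_theta assms) auto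
    finally show ?thesis .
  qed
  then show ?thesis by blast
qed

text \<open>
  With \<open>k = n - (n - k)\<close> the sum is \<open>n\<close> times a partial sum of the \<open>\<theta>\<^sub>k\<close> minus a partial first
  moment. The partial sum misses 1 by a tail, and \<open>n\<close> times this tail is again controlled by the
  first absolute moment, since the indices in the tail exceed \<open>n\<close>.
\<close>

lemma theta_conv_index_bounded:
  assumes "1 < \<beta>" "\<beta> < 2"
  shows "\<exists>C. \<forall>n. \<bar>(\<Sum>k\<le>n. theta \<beta> (n - k) * real k) - real n\<bar> \<le> C"
proof -
  define M where "M = (\<Sum>k. real k * \<bar>theta \<beta> k\<bar>)"
  note sm = summable_index_abs_theta[OF assms] summable_abs_theta[OF assms]
  have "\<bar>(\<Sum>k\<le>n. theta \<beta> (n - k) * real k) - real n\<bar> \<le> M + M" for n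
  proof -
    have "(\<Sum>k\<le>n. theta \<beta> (n - k) * real k) = (\<Sum>k\<le>n. theta \<beta> k * real (n - k))"
      by (rule convolution_flip)
    also have "\<dots> = real n * (\<Sum>k\<le>n. theta \<beta> k) - (\<Sum>k\<le>n. real k * theta \<beta> k)"
      unfolding sum_distrib_left sum_subtractf[symmetric]
      by (intro sum.cong refl) (simp add: of_nat_diff algebra_simps)
    also have "(\<Sum>k\<le>n. theta \<beta> k) = 1 - (\<Sum>k. theta \<beta> (k + Suc n))"
      using sums_split_initial_segment[OF theta_sums_one[OF assms], of "Suc n"]
      unfolding sums_iff lessThan_Suc_atMost by linarith
    finally have eq: "(\<Sum>k\<le>n. theta \<beta> (n - k) * real k) - real n
        = - real n * (\<Sum>k. theta \<beta> (k + Suc n)) - (\<Sum>k\<le>n. real k * theta \<beta> k)"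
      by (simp add: algebra_simps)
    have sm': "summable (\<lambda>k. real (k + Suc n) * \<bar>theta \<beta> (k + Suc n)\<bar>)" "summable (\<lambda>k. \<bar>theta \<beta> (k + Suc n)\<bar>)"
      using summable_ignore_initial_segment[OF sm(1), of "Suc n"]
        summable_ignore_initial_segment[OF sm(2), of "Suc n"] by simp_all
    \<comment> \<open>The weight \<open>n\<close> is at most the index of each term of the tail.\<close>
    have "\<bar>real n * (\<Sum>k. theta \<beta> (k + Suc n))\<bar> \<le> real n * (\<Sum>k. \<bar>theta \<beta> (k + Suc n)\<bar>)"
      using summable_rabs[OF sm'(2)] by (simp add: abs_mult mult_left_mono)
    also have "\<dots> = (\<Sum>k. real n * \<bar>theta \<beta> (k + Suc n)\<bar>)"
      using sm' by (simp add: suminf_mult)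
    also have "\<dots> \<le> (\<Sum>k. real (k + Suc n) * \<bar>theta \<beta> (k + Suc n)\<bar>)"
      using sm' by (intro suminf_le summable_mult mult_right_mono) auto
    also have "\<dots> \<le> M"
    proof -
      have "(\<Sum>k<Suc n. real k * \<bar>theta \<beta> k\<bar>) \<ge> 0"
        by (intro sum_nonneg) simp
      then show ?thesis
        using suminf_split_initial_segment[OF sm(1), of "Suc n"] unfolding M_def by linarith
    qed
    finally have 1: "\<bar>real n * (\<Sum>k. theta \<beta> (k + Suc n))\<bar> \<le> M" .
    have "\<bar>\<Sum>k\<le>n. real k * theta \<beta> k\<bar> \<le> (\<Sum>k\<le>n. real k * \<bar>theta \<beta> k\<bar>)"
      by (rule order.trans[OF sum_abs]) (simp add: abs_mult)
    also have "\<dots> \<le> M"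
      unfolding M_def by (intro sum_le_suminf sm) auto
    finally show ?thesis
      using 1 unfolding eq by linarith
  qed
  then show ?thesis by blast
qed

section \<open>Boundedness of the data terms\<close>

lemma A_coeff_bounded:
  assumes "1 < \<beta>" "\<beta> < 2"
  shows "\<exists>C. \<forall>n. \<bar>A_coeff \<beta> n\<bar> \<le> C"
proof -
  obtain C where C: "\<forall>n. \<bar>\<Sum>k\<le>n. alpha \<beta> (n - k) * real k powr \<beta>\<bar> \<le> C"
    using alpha_conv_powr_bounded[OF assms] ..
  obtain C' where C': "\<forall>n. \<bar>\<Sum>k\<le>n. theta \<beta> (n - k)\<bar> \<le> C'"
    using theta_sum_bounded[OF assms] ..
  have G: "Gamma (\<beta> + 1) > 0" using assms by (simp add: Gamma_real_pos)
  have "\<bar>A_coeff \<beta> n\<bar> \<le> C / Gamma (\<beta> + 1) + C'" for n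
  proof -
    have "\<bar>1 / Gamma (\<beta> + 1) * (\<Sum>k\<le>n. alpha \<beta> (n - k) * real k powr \<beta>)\<bar> \<le> C / Gamma (\<beta> + 1)"
      using G spec[OF C, of n] by (simp add: abs_mult divide_right_mono)
    with spec[OF C', of n] show ?thesis unfolding A_coeff_def by linarith
  qed
  then show ?thesis by blast
qed

lemma B_coeff_bounded:
  assumes "1 < \<beta>" "\<beta> < 2"
  shows "\<exists>C. \<forall>n. \<bar>B_coeff \<beta> n\<bar> \<le> C"
proof -
  obtain C where
    C: "\<forall>n. \<bar>(\<Sum>k\<le>n. alpha \<beta> (n - k) * real k powr (\<beta> + 1)) / Gamma (\<beta> + 2) - real n\<bar> \<le> C"
    using alpha_conv_powr_Suc_bounded[OF assms] ..
  obtain C' where C': "\<forall>n. \<bar>(\<Sum>k\<le>n. theta \<beta> (n - k) * real k) - real n\<bar> \<le> C'"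
    using theta_conv_index_bounded[OF assms] ..
  have "\<bar>B_coeff \<beta> n\<bar> \<le> C + C'" for n
    unfolding B_coeff_def times_divide_eq_left mult_1
    using spec[OF C, of n] spec[OF C', of n] by linarith
  then show ?thesis by blast
qed

lemma abs_sum_alpha_le_two:
  assumes "1 < \<beta>" "\<beta> < 2"
  shows "\<bar>\<Sum>k\<le>n. alpha \<beta> (n - k)\<bar> \<le> 2"
proof -
  have "(\<Sum>k\<le>n. alpha \<beta> (n - k)) = alpha (\<beta> - 1) n"
    using convolution_flip[of "alpha \<beta>" n "\<lambda>_. 1"] by (simp add: sum_alpha)
  also have "\<bar>alpha (\<beta> - 1) n\<bar> \<le> (\<Sum>k\<le>n. \<bar>alpha (\<beta> - 1) k\<bar>)"
    by (rule member_le_sum) auto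
  also have "\<dots> \<le> 2"
    using assms by (intro sum_abs_alpha_le) auto
  finally show ?thesis .
qed

text \<open>
  Convolving with \<open>k + 1\<close> instead of \<open>k\<close> gives the coefficients of
  \<open>(1 - z)\<^sup>\<beta> (1 - z)\<^sup>-\<^sup>2\<close>, which lie in \<open>[0, 1]\<close>.
\<close>

lemma abs_alpha_conv_index_le_three:
  assumes "1 < \<beta>" "\<beta> < 2"
  shows "\<bar>\<Sum>k\<le>n. alpha \<beta> (n - k) * real k\<bar> \<le> 3"
proof -
  have "(\<Sum>k\<le>n. alpha \<beta> (n - k) * real k) + (\<Sum>k\<le>n. alpha \<beta> (n - k)) = (\<Sum>k\<le>n. alpha \<beta> (n - k) * alpha (-2) k)"
    by (simp add: distrib_left sum.distrib)
  also have "\<dots> = (diff_fps \<beta> * diff_fps (-2)) $ n"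
    unfolding convolution_eq diff_fps_def ..
  also have "\<dots> = alpha (\<beta> - 2) n"
    by (simp add: diff_fps_mult)
  finally show ?thesis
    using abs_sum_alpha_le_two[OF assms, of n] alpha_le_one[of "\<beta> - 2" n] assms by simp
qed

section \<open>Lower bound for the symbol on the unit disc\<close>

text \<open>
  With \<open>c = - S\<^sup>* 2\<^sup>-\<^sup>\<beta>\<close> this is the generating function of the weights \<open>\<alpha>\<^sub>k - S\<^sup>* \<theta>\<^sub>k\<close> that act on
  the amplitudes.
\<close>

definition stability_symbol :: "real \<Rightarrow> real \<Rightarrow> complex \<Rightarrow> complex" where
  "stability_symbol \<beta> c z = (1 - z) powr of_real \<beta> + of_real c * (1 + z) powr of_real \<beta>"

definition stability_symbol_fps :: "real \<Rightarrow> real \<Rightarrow> complex fps" where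
  "stability_symbol_fps \<beta> c = Abs_fps (\<lambda>n. of_real (alpha \<beta> n + c * (\<beta> gchoose n)))"

lemma powr_of_real_polar:
  assumes "w \<noteq> 0"
  shows "w powr of_real \<beta> = of_real (norm w powr \<beta>) * cis (\<beta> * Im (Ln w))"
proof -
  have "complex_of_real \<beta> * Ln w = of_real (\<beta> * ln (norm w)) + \<i> * of_real (\<beta> * Im (Ln w))"
    using assms by (simp add: complex_eq_iff)
  then show ?thesis
    using assms by (simp add: powr_def exp_add cis_conv_exp exp_of_real[symmetric])
qed

lemma norm_powr_of_real:
  assumes "w \<noteq> 0"
  shows "norm (w powr complex_of_real \<beta>) = norm w powr \<beta>"
  using powr_of_real_polar[OF assms, of \<beta>] by (simp add: norm_mult)

lemma norm_lt_one_imp_Re_pos: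
  fixes z :: complex
  assumes "norm z < 1"
  shows "Re (1 - z) > 0" "Re (1 + z) > 0"
  using abs_Re_le_cmod[of z] assms by auto

lemma norm_lt_one_imp_nonzero:
  fixes z :: complex
  assumes "norm z < 1"
  shows "1 - z \<noteq> 0" "1 + z \<noteq> 0"
  using norm_lt_one_imp_Re_pos[OF assms] by (auto simp: complex_eq_iff)

text \<open>
  The product of \<open>1 - z\<close> with the conjugate of \<open>1 + z\<close> has real part \<open>1 - |z|\<^sup>2 > 0\<close>, and the cosine
  of the difference of the arguments has the sign of this real part.
\<close>

lemma abs_Im_Ln_diff_less:
  assumes "norm z < 1"
  shows "\<bar>Im (Ln (1 - z)) - Im (Ln (1 + z))\<bar> < pi / 2"
proof (rule ccontr)
  define u where "u = Im (Ln (1 - z))"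
  define v where "v = Im (Ln (1 + z))"
  note Re = norm_lt_one_imp_Re_pos[OF assms]
  note nz = norm_lt_one_imp_nonzero[OF assms]
  have uv: "\<bar>u\<bar> < pi / 2" "\<bar>v\<bar> < pi / 2"
    unfolding u_def v_def using Re Re_Ln_pos_lt nz by blast+
  assume "\<not> \<bar>Im (Ln (1 - z)) - Im (Ln (1 + z))\<bar> < pi / 2"
  then have "cos \<bar>u - v\<bar> \<le> cos (pi / 2)"
    using uv by (intro cos_monotone_0_pi_le) (auto simp: u_def v_def)
  then have "cos (u - v) \<le> 0" by (simp add: cos_abs_real)
  have polar: "w = of_real (norm w) * cis (Im (Ln w))" if "w \<noteq> 0" for w
    using powr_of_real_polar[OF that, of 1] that by simp
  have "(1 - z) * cnj (1 + z) = of_real (norm (1 - z) * norm (1 + z)) * cis (u - v)"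
    using arg_cong2[where f = "\<lambda>x y. x * cnj y", OF polar[OF nz(1)] polar[OF nz(2)]]
    by (simp add: u_def v_def cis_cnj cis_mult mult_ac)
  then have "Re ((1 - z) * cnj (1 + z)) = norm (1 - z) * norm (1 + z) * cos (u - v)"
    by simp
  also have "\<dots> \<le> 0"
    using \<open>cos (u - v) \<le> 0\<close> by (simp add: mult_nonneg_nonpos)
  finally have "1 - (Re z ^ 2 + Im z ^ 2) \<le> 0"
    by (simp add: power2_eq_square algebra_simps)
  moreover have "Re z ^ 2 + Im z ^ 2 < 1"
    using assms by (simp add: cmod_def)
  ultimately show False by simp
qed

lemma cos_quarter_pi_pos:
  assumes "0 \<le> \<beta>" "\<beta> < 2"
  shows "cos (\<beta> * pi / 4) > 0"
proof (rule cos_gt_zero_pi)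
  have "0 \<le> \<beta> * pi / 4"
    using assms by simp
  then show "- (pi / 2) < \<beta> * pi / 4"
    using pi_gt_zero by linarith
  show "\<beta> * pi / 4 < pi / 2"
    using assms mult_strict_right_mono[of \<beta> 2 pi] by simp
qed

text \<open>
  Rotating by the mean of the two arguments puts both terms into the sector of half-angle
  \<open>\<beta>\<pi>/4 < \<pi>/2\<close> around the positive real axis, where the real part controls the modulus. One of
  \<open>|1 - z|\<close> and \<open>|1 + z|\<close> is at least 1, so the terms are not both small.
\<close>

lemma norm_stability_symbol_ge:
  assumes \<beta>: "0 \<le> \<beta>" "\<beta> < 2" and c: "c > 0" and z: "norm z < 1"
  shows "norm (stability_symbol \<beta> c z) \<ge> cos (\<beta> * pi / 4) * min 1 c"
proof -
  define u where "u = Im (Ln (1 - z))"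
  define v where "v = Im (Ln (1 + z))"
  define x where "x = norm (1 - z)"
  define y where "y = norm (1 + z)"
  \<comment> \<open>Half the angle between the two terms of the symbol.\<close>
  define d where "d = \<beta> * (u - v) / 2"
  note nz = norm_lt_one_imp_nonzero[OF z]
  note cos_pos = less_imp_le[OF cos_quarter_pi_pos[OF \<beta>]]
  have "\<bar>d\<bar> = \<beta> * \<bar>u - v\<bar> / 2"
    using \<beta> by (simp add: d_def abs_mult)
  also have "\<dots> \<le> \<beta> * (pi / 2) / 2"
    using \<beta> abs_Im_Ln_diff_less[OF z] by (intro divide_right_mono mult_left_mono) (auto simp: u_def v_def)
  finally have d: "\<bar>d\<bar> \<le> \<beta> * pi / 4" by simp
  have "\<beta> * pi / 4 \<le> pi" using \<beta> pi_gt_zero mult_right_mono[of \<beta> 2 pi] by simp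
  then have "cos (\<beta> * pi / 4) \<le> cos \<bar>d\<bar>"
    using d by (intro cos_monotone_0_pi_le) auto
  then have cos_d: "cos (\<beta> * pi / 4) \<le> cos d" by simp
  have "x + y \<ge> norm ((1 - z) + (1 + z))"
    unfolding x_def y_def by (rule norm_triangle_ineq)
  then have "x \<ge> 1 \<or> y \<ge> 1" by auto
  then have "min 1 c \<le> x powr \<beta> + c * y powr \<beta>"
  proof
    assume "x \<ge> 1"
    then have "1 \<le> x powr \<beta>" using \<beta> by (simp add: ge_one_powr_ge_zero)
    moreover have "0 \<le> c * y powr \<beta>" using c by simp
    ultimately show ?thesis by linarith
  next
    assume "y \<ge> 1"
    then have "c * 1 \<le> c * y powr \<beta>" using \<beta> c by (intro mult_left_mono ge_one_powr_ge_zero) auto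
    moreover have "0 \<le> x powr \<beta>" by simp
    ultimately show ?thesis by linarith
  qed
  then have "cos (\<beta> * pi / 4) * min 1 c \<le> cos (\<beta> * pi / 4) * (x powr \<beta> + c * y powr \<beta>)"
    using cos_pos by (rule mult_left_mono)
  also have "\<dots> \<le> cos d * (x powr \<beta> + c * y powr \<beta>)"
    using cos_d c by (intro mult_right_mono) auto
  also have "\<dots> = Re (cis (- (\<beta> * (u + v) / 2)) * stability_symbol \<beta> c z)"
  proof -
    have *: "cis (- (\<beta> * (u + v) / 2)) * stability_symbol \<beta> c z
        = of_real (x powr \<beta>) * (cis (- (\<beta> * (u + v) / 2)) * cis (\<beta> * u)) + of_real (c * y powr \<beta>) * (cis (- (\<beta> * (u + v) / 2)) * cis (\<beta> * v))"
      unfolding stability_symbol_def powr_of_real_polar[OF nz(1)] powr_of_real_polar[OF nz(2)]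
      by (simp add: x_def y_def u_def v_def algebra_simps)
    have angle: "- (\<beta> * (u + v) / 2) + \<beta> * u = d" "- (\<beta> * (u + v) / 2) + \<beta> * v = - d"
      by (simp_all add: d_def field_simps)
    show ?thesis
      unfolding * cis_mult angle by (simp add: algebra_simps)
  qed
  also have "\<dots> \<le> norm (cis (- (\<beta> * (u + v) / 2)) * stability_symbol \<beta> c z)"
    by (rule complex_Re_le_cmod)
  also have "\<dots> = norm (stability_symbol \<beta> c z)"
    by (simp add: norm_mult)
  finally show ?thesis .
qed

section \<open>Summability of the inverse symbol\<close>

lemma stability_symbol_has_fps_expansion:
  "stability_symbol \<beta> c has_fps_expansion stability_symbol_fps \<beta> c"
proof (rule has_fps_expansionI)
  have "\<forall>\<^sub>F z in nhds (0 :: complex). z \<in> ball 0 1"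
    by (rule eventually_nhds_in_open) auto
  then show "\<forall>\<^sub>F z in nhds 0. (\<lambda>n. stability_symbol_fps \<beta> c $ n * z ^ n) sums stability_symbol \<beta> c z"
  proof eventually_elim
    case (elim z)
    then have "norm z < 1" "norm (-z) < 1" by auto
    have gb: "complex_of_real \<beta> gchoose n = of_real (\<beta> gchoose n)" for n
      by (simp add: gbinomial_prod_rev)
    have "(\<lambda>n. (complex_of_real \<beta> gchoose n) * (-z) ^ n + of_real c * ((complex_of_real \<beta> gchoose n) * z ^ n))
        sums ((1 + -z) powr of_real \<beta> + of_real c * (1 + z) powr of_real \<beta>)"
      by (intro sums_add sums_mult gen_binomial_complex) fact+
    also have "(\<lambda>n. (complex_of_real \<beta> gchoose n) * (-z) ^ n + of_real c * ((complex_of_real \<beta> gchoose n) * z ^ n))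
        = (\<lambda>n. stability_symbol_fps \<beta> c $ n * z ^ n)"
      by (rule ext) (simp add: stability_symbol_fps_def alpha_def gb power_minus[of z] algebra_simps)
    finally show ?case by (simp add: stability_symbol_def)
  qed
qed

text \<open>
  The second derivative of a reciprocal, together with the holomorphy that makes it meaningful:
  the lower bound on the symbol excludes zeros in the disc.
\<close>

lemma inverse_stability_symbol_second_deriv:
  fixes \<beta> c :: real and z :: complex
  assumes \<beta>: "0 \<le> \<beta>" "\<beta> < 2" and c: "c > 0" and z: "norm z < 1"
  defines "s \<equiv> stability_symbol \<beta> c"
    and "s1 \<equiv> \<lambda>z. of_real \<beta> * (of_real c * (1 + z) powr of_real (\<beta> - 1) - (1 - z) powr of_real (\<beta> - 1))"
    and "s2 \<equiv> \<lambda>z. of_real (\<beta> * (\<beta> - 1)) * stability_symbol (\<beta> - 2) c z"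
  shows "(\<lambda>z. inverse (s z)) holomorphic_on ball 0 1"
    and "deriv (deriv (\<lambda>z. inverse (s z))) z = 2 * s1 z ^ 2 / s z ^ 3 - s2 z / s z ^ 2"
proof -
  note cos_pos = cos_quarter_pi_pos[OF \<beta>]
  have nz: "s w \<noteq> 0" if "norm w < 1" for w
  proof -
    have "0 < cos (\<beta> * pi / 4) * min 1 c" using cos_pos c by simp
    then show ?thesis
      using norm_stability_symbol_ge[OF \<beta> c that] unfolding s_def by auto
  qed
  have slit: "1 - w \<notin> \<real>\<^sub>\<le>\<^sub>0" "1 + w \<notin> \<real>\<^sub>\<le>\<^sub>0" "1 - w \<noteq> 0" "1 + w \<noteq> 0" if "norm w < 1" for w :: complex
    using norm_lt_one_imp_Re_pos[OF that] norm_lt_one_imp_nonzero[OF that]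
    by (auto simp: complex_nonpos_Reals_iff)
  have s: "(s has_field_derivative s1 w) (at w)" if "norm w < 1" for w
    unfolding s_def s1_def stability_symbol_def[abs_def]
    by (rule derivative_eq_intros refl slit[OF that] | simp add: algebra_simps)+
  have s1: "(s1 has_field_derivative s2 w) (at w)" if "norm w < 1" for w
    unfolding s2_def s1_def stability_symbol_def[abs_def]
    by (rule derivative_eq_intros refl slit[OF that] | simp add: algebra_simps)+
  have f: "((\<lambda>z. inverse (s z)) has_field_derivative - s1 w / s w ^ 2) (at w)" if "norm w < 1" for w
    using nz[OF that] by (auto intro!: derivative_eq_intros s that simp: power2_eq_square field_simps)
  show "(\<lambda>z. inverse (s z)) holomorphic_on ball 0 1"
    unfolding holomorphic_on_open[OF open_ball] using f by (metis mem_ball_0)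
  have "((\<lambda>z. - s1 z / s z ^ 2) has_field_derivative 2 * s1 z ^ 2 / s z ^ 3 - s2 z / s z ^ 2) (at z)"
    using nz[OF z] by (auto intro!: derivative_eq_intros s s1 z simp: power2_eq_square power3_eq_cube field_simps)
  then have "(deriv (\<lambda>z. inverse (s z)) has_field_derivative 2 * s1 z ^ 2 / s z ^ 3 - s2 z / s z ^ 2) (at z)"
    by (rule has_field_derivative_transform_within_open[where S = "ball 0 1"]) (use z DERIV_imp_deriv[OF f] in auto)
  then show "deriv (deriv (\<lambda>z. inverse (s z))) z = 2 * s1 z ^ 2 / s z ^ 3 - s2 z / s z ^ 2"
    by (rule DERIV_imp_deriv)
qed

text \<open>
  Both branch points lie on the unit circle, so \<open>|1 \<plusminus> z| \<ge> 1 - |z|\<close>; the exponent \<open>\<beta> - 2\<close> is negative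
  and occurs only in the second derivative of the symbol, while its first derivative stays bounded
  because \<open>\<beta> > 1\<close>.
\<close>

lemma inverse_stability_symbol_second_deriv_bound:
  assumes \<beta>: "1 < \<beta>" "\<beta> < 2" and c: "c > 0"
  shows "\<exists>K\<ge>0. \<forall>z. norm z < 1 \<longrightarrow>
    norm (deriv (deriv (\<lambda>z. inverse (stability_symbol \<beta> c z))) z) \<le> K * (1 - norm z) powr (\<beta> - 2)"
proof -
  define \<delta> where "\<delta> = cos (\<beta> * pi / 4) * min 1 c"
  have "cos (\<beta> * pi / 4) > 0"
    using \<beta> by (intro cos_quarter_pi_pos) auto
  then have \<delta>: "\<delta> > 0" using c by (simp add: \<delta>_def)
  define S1 where "S1 = \<beta> * (2 * c + 2)"
  define S2 where "S2 = \<beta> * (\<beta> - 1) * (1 + c)"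
  define K where "K = 2 * S1 ^ 2 / \<delta> ^ 3 + S2 / \<delta> ^ 2"
  have nonneg: "S1 \<ge> 0" "S2 \<ge> 0" using \<beta> c by (auto simp: S1_def S2_def)
  have K: "K \<ge> 0" unfolding K_def using nonneg \<delta> by simp
  have "norm (deriv (deriv (\<lambda>z. inverse (stability_symbol \<beta> c z))) z) \<le> K * (1 - norm z) powr (\<beta> - 2)"
    if z: "norm z < 1" for z
  proof -
    define s where "s = stability_symbol \<beta> c z"
    define s1 where "s1 = of_real \<beta> * (of_real c * (1 + z) powr of_real (\<beta> - 1) - (1 - z) powr of_real (\<beta> - 1))"
    define s2 where "s2 = of_real (\<beta> * (\<beta> - 1)) * stability_symbol (\<beta> - 2) c z"
    define p where "p = (1 - norm z) powr (\<beta> - 2)"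
    note nz = norm_lt_one_imp_nonzero[OF z]
    have s: "norm s \<ge> \<delta>"
      unfolding s_def \<delta>_def using \<beta> c z by (intro norm_stability_symbol_ge) auto
    have le2: "norm w powr (\<beta> - 1) \<le> 2" if "norm w \<le> 2" for w :: complex
    proof -
      have "norm w powr (\<beta> - 1) \<le> 2 powr (\<beta> - 1)" using \<beta> that by (intro powr_mono2) auto
      also have "\<dots> \<le> 2 powr 1" using \<beta> by (intro powr_mono) auto
      finally show ?thesis by simp
    qed
    have "norm (1 - z) \<le> 2" "norm (1 + z) \<le> 2"
      using norm_triangle_ineq4[of 1 z] norm_triangle_ineq[of 1 z] z by auto
    then have w: "norm ((1 - z) powr complex_of_real (\<beta> - 1)) \<le> 2" "norm ((1 + z) powr complex_of_real (\<beta> - 1)) \<le> 2"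
      unfolding norm_powr_of_real[OF nz(1)] norm_powr_of_real[OF nz(2)] by (auto intro: le2)
    have "norm (of_real c * (1 + z) powr of_real (\<beta> - 1) - (1 - z) powr complex_of_real (\<beta> - 1)) \<le> c * 2 + 2"
      by (rule order.trans[OF norm_triangle_ineq4], rule add_mono)
        (use c w in \<open>simp_all add: norm_mult\<close>)
    then have s1: "norm s1 \<le> S1"
      unfolding s1_def S1_def using \<beta> by (simp add: norm_mult mult_ac)
    have "norm (1 - z) \<ge> 1 - norm z" "norm (1 + z) \<ge> 1 - norm z"
      using norm_triangle_ineq2[of 1 z] norm_triangle_ineq2[of 1 "-z"] by auto
    then have "norm (1 - z) powr (\<beta> - 2) \<le> p" "norm (1 + z) powr (\<beta> - 2) \<le> p"
      unfolding p_def using \<beta> z by (auto intro!: powr_mono2')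
    then have w: "norm ((1 - z) powr complex_of_real (\<beta> - 2)) \<le> p" "norm ((1 + z) powr complex_of_real (\<beta> - 2)) \<le> p"
      unfolding norm_powr_of_real[OF nz(1)] norm_powr_of_real[OF nz(2)] by auto
    have "norm (stability_symbol (\<beta> - 2) c z) \<le> p + c * p"
      unfolding stability_symbol_def
      by (rule order.trans[OF norm_triangle_ineq], rule add_mono)
        (use c w in \<open>simp_all add: norm_mult\<close>)
    then have "norm s2 \<le> \<beta> * (\<beta> - 1) * (p + c * p)"
      unfolding s2_def norm_mult norm_of_real using \<beta> by (simp add: mult_left_mono)
    also have "\<dots> = S2 * p" by (simp add: S2_def algebra_simps)
    finally have s2: "norm s2 \<le> S2 * p" .
    have p: "p \<ge> 1"
    proof -
      have "(1 - norm z) powr 0 \<le> (1 - norm z) powr (\<beta> - 2)"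
        using \<beta> z by (intro powr_mono') auto
      then show ?thesis using z by (simp add: p_def)
    qed
    have "deriv (deriv (\<lambda>z. inverse (stability_symbol \<beta> c z))) z = 2 * s1 ^ 2 / s ^ 3 - s2 / s ^ 2"
      unfolding s_def s1_def s2_def using \<beta> c z by (intro inverse_stability_symbol_second_deriv(2)) auto
    also have "norm \<dots> \<le> 2 * S1 ^ 2 / \<delta> ^ 3 + S2 * p / \<delta> ^ 2"
    proof (rule order.trans[OF norm_triangle_ineq4], rule add_mono)
      have "2 * norm s1 ^ 2 / norm s ^ 3 \<le> 2 * S1 ^ 2 / \<delta> ^ 3"
        using s s1 \<delta> by (intro frac_le mult_left_mono power_mono) auto
      then show "norm (2 * s1 ^ 2 / s ^ 3) \<le> 2 * S1 ^ 2 / \<delta> ^ 3"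
        by (simp add: norm_divide norm_mult norm_power)
      have "norm s2 / norm s ^ 2 \<le> S2 * p / \<delta> ^ 2"
        using s s2 \<delta> nonneg p by (intro frac_le power_mono) auto
      then show "norm (s2 / s ^ 2) \<le> S2 * p / \<delta> ^ 2"
        by (simp add: norm_divide norm_power)
    qed
    also have "\<dots> \<le> 2 * S1 ^ 2 / \<delta> ^ 3 * p + S2 * p / \<delta> ^ 2"
      using p \<delta> mult_left_mono[OF p, of "2 * S1 ^ 2 / \<delta> ^ 3"] by simp
    also have "\<dots> = K * p" by (simp add: K_def algebra_simps)
    finally show ?thesis unfolding p_def .
  qed
  with K show ?thesis by blast
qed

text \<open>
  An instance of Wiener's lemma that needs only Cauchy's inequality. The second derivative grows
  like \<open>(1 - |z|)\<^sup>\<beta>\<^sup>-\<^sup>2\<close>, so on a circle at distance about \<open>1/n\<close> from the boundary it is of size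
  \<open>n\<^sup>2\<^sup>-\<^sup>\<beta>\<close>. Its coefficients carry an extra factor of order \<open>n\<^sup>2\<close>, which leaves \<open>O(n\<^sup>-\<^sup>\<beta>)\<close> for those of the
  inverse itself.
\<close>

lemma summable_inverse_stability_symbol_fps:
  assumes \<beta>: "1 < \<beta>" "\<beta> < 2" and c: "c > 0"
  shows "summable (\<lambda>n. norm (inverse (stability_symbol_fps \<beta> c) $ n))"
proof -
  define f where "f = (\<lambda>z. inverse (stability_symbol \<beta> c z))"
  define F where "F = inverse (stability_symbol_fps \<beta> c)"
  define g where "g = deriv (deriv f)"
  from inverse_stability_symbol_second_deriv_bound[OF assms] obtain K where
    K: "K \<ge> 0" "\<And>z. norm z < 1 \<Longrightarrow> norm (g z) \<le> K * (1 - norm z) powr (\<beta> - 2)"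
    unfolding g_def f_def by blast
  have "f holomorphic_on ball 0 1"
    unfolding f_def using \<beta> c by (intro inverse_stability_symbol_second_deriv(1)[of \<beta> c 0]) auto
  then have hol: "g holomorphic_on ball 0 1"
    unfolding g_def by (intro holomorphic_deriv) auto
  have "complex_of_real (1 + c) \<noteq> 0"
    using c unfolding of_real_eq_0_iff by simp
  then have "f has_fps_expansion F"
    unfolding f_def F_def
    by (intro has_fps_expansion_inverse stability_symbol_has_fps_expansion) (simp add: stability_symbol_fps_def)
  then have g: "g has_fps_expansion fps_deriv (fps_deriv F)"
    unfolding g_def by (intro has_fps_expansion_deriv)
  have bound: "norm (F $ (n + 2)) \<le> 6 * K * real (n + 2) powr (-\<beta>)" for n
  proof -
    \<comment> \<open>For this radius \<open>1 - r = 1 / (n + 2)\<close>, while \<open>1 / r\<^sup>n\<close> stays below \<open>exp 1\<close>.\<close>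
    define r where "r = real (n + 1) / real (n + 2)"
    have r: "0 < r" "r < 1" by (auto simp: r_def)
    have "1 - r = 1 / real (n + 2)" by (simp add: r_def field_simps)
    then have r': "(1 - r) powr (\<beta> - 2) = real (n + 2) powr (2 - \<beta>)"
      by (simp add: powr_divide powr_diff)
    have le: "norm ((deriv ^^ n) g 0) \<le> fact n * (K * real (n + 2) powr (2 - \<beta>)) / r ^ n"
    proof (rule Cauchy_inequality)
      show "g holomorphic_on ball 0 r"
        using hol by (rule holomorphic_on_subset) (use r in auto)
      show "continuous_on (cball 0 r) g"
        by (rule continuous_on_subset[OF holomorphic_on_imp_continuous_on[OF hol]]) (use r in auto)
      show "norm (g x) \<le> K * real (n + 2) powr (2 - \<beta>)" if "norm (0 - x) = r" for x
        using K(2)[of x] that r r' by simp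
    qed (use r in auto)
    have "(of_nat (n + 1) * of_nat (n + 2)) * F $ (n + 2) = (deriv ^^ n) g 0 / fact n"
      using fps_nth_fps_expansion[OF g, of n] by (simp add: mult.assoc algebra_simps)
    then have "real (n + 1) * real (n + 2) * norm (F $ (n + 2)) = norm ((deriv ^^ n) g 0) / fact n"
      by (metis (no_types, lifting) norm_divide norm_fact norm_mult norm_of_nat)
    then have "real (n + 1) * real (n + 2) * norm (F $ (n + 2)) \<le> fact n * (K * real (n + 2) powr (2 - \<beta>)) / r ^ n / fact n"
      using divide_right_mono[OF le, of "fact n"] by simp
    also have "\<dots> = K * real (n + 2) powr (2 - \<beta>) * (1 / r) ^ n"
      by (simp add: power_divide)
    also have "\<dots> \<le> K * real (n + 2) powr (2 - \<beta>) * 3"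
    proof -
      have r_inv: "1 / r = 1 + 1 / real (n + 1)"
        by (simp add: r_def field_simps)
      have "(1 / r) ^ n \<le> (1 / r) ^ (n + 1)"
        using r by (intro power_increasing) auto
      also have "\<dots> \<le> exp 1"
        unfolding r_inv using exp_ge_one_plus_x_over_n_power_n[of "n + 1" 1] by simp
      also have "\<dots> \<le> (3 :: real)" by (rule exp_le)
      finally show ?thesis using K(1) by (intro mult_left_mono) auto
    qed
    finally have *: "real (n + 1) * real (n + 2) * norm (F $ (n + 2)) \<le> 3 * K * real (n + 2) powr (2 - \<beta>)"
      by (simp add: mult_ac)
    have "real (n + 2) powr 2 * norm (F $ (n + 2)) \<le> 2 * (real (n + 1) * real (n + 2) * norm (F $ (n + 2)))"
    proof -
      have "real (n + 2) powr 2 = real (n + 2) ^ 2" by (rule powr_numeral) simp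
      moreover have "real (n + 2) ^ 2 \<le> 2 * (real (n + 1) * real (n + 2))"
        by (simp add: power2_eq_square algebra_simps)
      ultimately show ?thesis
        using mult_right_mono[of "real (n + 2) powr 2" "2 * (real (n + 1) * real (n + 2))" "norm (F $ (n + 2))"]
        by (simp add: mult_ac)
    qed
    also have "\<dots> \<le> 6 * K * real (n + 2) powr (2 - \<beta>)"
      using * by simp
    also have "real (n + 2) powr (2 - \<beta>) = real (n + 2) powr 2 * real (n + 2) powr (-\<beta>)"
      unfolding powr_add[symmetric] by simp
    finally have "real (n + 2) powr 2 * norm (F $ (n + 2)) \<le> real (n + 2) powr 2 * (6 * K * real (n + 2) powr (-\<beta>))"
      by (simp add: mult_ac)
    then show ?thesis
      by (rule mult_left_le_imp_le) simp
  qed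
  have "summable (\<lambda>n. real n powr (-\<beta>))"
    using \<beta> by (simp add: summable_real_powr_iff)
  then have "summable (\<lambda>n. 6 * K * real (n + 2) powr (-\<beta>))"
    by (intro summable_mult summable_ignore_initial_segment[where f = "\<lambda>n. real n powr (-\<beta>)"])
  then have "summable (\<lambda>n. norm (F $ (n + 2)))"
    by (rule summable_comparison_test'[where N = 0]) (use bound in simp)
  then show ?thesis
    unfolding F_def using summable_iff_shift[of "\<lambda>n. norm (F $ n)" 2] by (simp add: F_def)
qed

section \<open>Boundedness of the amplitudes\<close>

text \<open>
  The amplitude equation as an identity between formal power series. The coefficient at \<open>n = 0\<close>
  is covered too: there both sides of the amplitude equation vanish, since \<open>A\<^sub>0 = - \<theta>\<^sub>0\<close> and
  \<open>B\<^sub>0 = 0\<close>.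
\<close>

lemma amplitude_equation_as_convolution:
  assumes "amplitude_sequence \<beta> \<mu> \<tau> h \<sigma> \<rho>0 d0 \<rho>"
  defines "S \<equiv> S_star \<beta> \<mu> \<tau> h \<sigma>"
  shows "stability_symbol_fps \<beta> (- S * 2 powr (-\<beta>)) * Abs_fps \<rho> =
    Abs_fps (\<lambda>n. \<rho>0 * of_real ((\<Sum>k\<le>n. alpha \<beta> (n - k)) + S * A_coeff \<beta> n)
      + d0 * of_real (\<tau> * ((\<Sum>k\<le>n. alpha \<beta> (n - k) * real k) + S * B_coeff \<beta> n)))"
    (is "?Q * _ = Abs_fps ?r")
proof (rule fps_ext)
  fix n
  have eq: "amplitude_equation \<beta> \<mu> \<tau> h \<sigma> d0 \<rho> n"
  proof (cases "n = 0")
    case True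
    then show ?thesis
      by (simp add: amplitude_equation_def A_coeff_def B_coeff_def)
  next
    case False
    then show ?thesis
      using assms(1) by (simp add: amplitude_sequence_def)
  qed
  have "(?Q * Abs_fps \<rho>) $ n = (\<Sum>k\<le>n. \<rho> k * (?Q $ (n - k)))"
    by (subst mult.commute) (simp add: fps_mult_nth atLeast0AtMost)
  also have "\<dots> = (\<Sum>k\<le>n. of_real (alpha \<beta> (n - k)) * \<rho> k - of_real S * (of_real (theta \<beta> (n - k)) * \<rho> k))"
    by (rule sum.cong) (simp_all add: stability_symbol_fps_def theta_eq_gbinomial algebra_simps)
  also have "\<dots> = (\<Sum>k\<le>n. of_real (alpha \<beta> (n - k)) * \<rho> k) - of_real S * (\<Sum>k\<le>n. of_real (theta \<beta> (n - k)) * \<rho> k)"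
    by (simp add: sum_subtractf sum_distrib_left)
  also have "(\<Sum>k\<le>n. of_real (alpha \<beta> (n - k)) * \<rho> k)
      = (\<Sum>k\<le>n. of_real (alpha \<beta> (n - k)) * (\<rho> k - \<rho> 0 - d0 * of_real (real k * \<tau>)))
        + \<rho> 0 * of_real (\<Sum>k\<le>n. alpha \<beta> (n - k)) + d0 * of_real (\<tau> * (\<Sum>k\<le>n. alpha \<beta> (n - k) * real k))"
    by (simp add: sum_distrib_left algebra_simps sum.distrib sum_subtractf)
  also have "\<dots> - of_real S * (\<Sum>k\<le>n. of_real (theta \<beta> (n - k)) * \<rho> k) = ?r n"
    using eq assms(1) unfolding amplitude_equation_def amplitude_sequence_def S_def[symmetric]
    by (simp add: algebra_simps)
  finally show "(?Q * Abs_fps \<rho>) $ n = Abs_fps ?r $ n" by simp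
qed

lemma norm_fps_mult_nth_le:
  fixes F :: "complex fps"
  assumes "summable (\<lambda>n. norm (F $ n))" "\<And>n. norm (r n) \<le> M"
  shows "norm ((F * Abs_fps r) $ n) \<le> (\<Sum>k. norm (F $ k)) * M"
proof -
  have M: "M \<ge> 0" using order.trans[OF norm_ge_zero assms(2)] .
  have "norm ((F * Abs_fps r) $ n) \<le> (\<Sum>k\<le>n. norm (F $ k) * norm (r (n - k)))"
    unfolding fps_mult_nth atLeast0AtMost
    by (rule order.trans[OF norm_sum]) (simp add: norm_mult)
  also have "\<dots> \<le> (\<Sum>k\<le>n. norm (F $ k) * M)"
    by (intro sum_mono mult_left_mono assms) auto
  also have "\<dots> = (\<Sum>k\<le>n. norm (F $ k)) * M"
    by (simp add: sum_distrib_right)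
  also have "\<dots> \<le> (\<Sum>k. norm (F $ k)) * M"
    by (intro mult_right_mono sum_le_suminf assms M) auto
  finally show ?thesis .
qed

text \<open>
  Dividing the power series identity by the symbol writes the amplitudes as the convolution of an
  absolutely summable sequence with bounded data.
\<close>

lemma amplitude_sequence_bounded:
  assumes \<beta>: "1 < \<beta>" "\<beta> < 2" and \<rho>: "amplitude_sequence \<beta> \<mu> \<tau> h \<sigma> \<rho>0 d0 \<rho>"
    and S: "S_star \<beta> \<mu> \<tau> h \<sigma> < 0"
  shows "bounded (range \<rho>)"
proof -
  define S where "S = S_star \<beta> \<mu> \<tau> h \<sigma>"
  define c where "c = - S * 2 powr (-\<beta>)"
  define Q where "Q = stability_symbol_fps \<beta> c"
  define r where "r n = \<rho>0 * of_real ((\<Sum>k\<le>n. alpha \<beta> (n - k)) + S * A_coeff \<beta> n)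
      + d0 * of_real (\<tau> * ((\<Sum>k\<le>n. alpha \<beta> (n - k) * real k) + S * B_coeff \<beta> n))" for n
  have c: "c > 0" using assms(4) by (simp add: c_def S_def mult_neg_pos)
  obtain A where A: "\<forall>n. \<bar>A_coeff \<beta> n\<bar> \<le> A" using A_coeff_bounded[OF \<beta>] ..
  obtain B where B: "\<forall>n. \<bar>B_coeff \<beta> n\<bar> \<le> B" using B_coeff_bounded[OF \<beta>] ..
  define M where "M = norm \<rho>0 * (2 + \<bar>S\<bar> * A) + norm d0 * (\<bar>\<tau>\<bar> * (3 + \<bar>S\<bar> * B))"
  have r: "norm (r n) \<le> M" for n
  proof -
    have "\<bar>(\<Sum>k\<le>n. alpha \<beta> (n - k)) + S * A_coeff \<beta> n\<bar> \<le> 2 + \<bar>S\<bar> * A"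
      using abs_sum_alpha_le_two[OF \<beta>, of n] mult_left_mono[OF spec[OF A, of n], of "\<bar>S\<bar>"]
        abs_triangle_ineq[of "\<Sum>k\<le>n. alpha \<beta> (n - k)" "S * A_coeff \<beta> n"]
      by (simp add: abs_mult)
    then have 1: "norm (\<rho>0 * of_real ((\<Sum>k\<le>n. alpha \<beta> (n - k)) + S * A_coeff \<beta> n)) \<le> norm \<rho>0 * (2 + \<bar>S\<bar> * A)"
      unfolding norm_mult norm_of_real by (intro mult_left_mono) auto
    have "\<bar>(\<Sum>k\<le>n. alpha \<beta> (n - k) * real k) + S * B_coeff \<beta> n\<bar> \<le> 3 + \<bar>S\<bar> * B"
      using abs_alpha_conv_index_le_three[OF \<beta>, of n] mult_left_mono[OF spec[OF B, of n], of "\<bar>S\<bar>"]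
        abs_triangle_ineq[of "\<Sum>k\<le>n. alpha \<beta> (n - k) * real k" "S * B_coeff \<beta> n"]
      by (simp add: abs_mult)
    then have 2: "norm (d0 * of_real (\<tau> * ((\<Sum>k\<le>n. alpha \<beta> (n - k) * real k) + S * B_coeff \<beta> n))) \<le> norm d0 * (\<bar>\<tau>\<bar> * (3 + \<bar>S\<bar> * B))"
      unfolding norm_mult norm_of_real abs_mult by (intro mult_left_mono) auto
    show ?thesis
      unfolding r_def M_def by (rule order.trans[OF norm_triangle_ineq add_mono[OF 1 2]])
  qed
  have "Q * Abs_fps \<rho> = Abs_fps r"
    using amplitude_equation_as_convolution[OF \<rho>] unfolding Q_def c_def r_def S_def .
  moreover have "complex_of_real (1 + c) \<noteq> 0"
    using c unfolding of_real_eq_0_iff by simp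
  then have "inverse Q * Q = 1"
    unfolding Q_def by (intro inverse_mult_eq_1) (simp add: stability_symbol_fps_def)
  ultimately have "Abs_fps \<rho> = inverse Q * Abs_fps r"
    by (metis mult.assoc mult_1)
  then have "\<rho> n = (inverse Q * Abs_fps r) $ n" for n
    by (metis fps_nth_Abs_fps)
  then have "norm (\<rho> n) \<le> (\<Sum>k. norm (inverse Q $ k)) * M" for n
    using norm_fps_mult_nth_le[OF summable_inverse_stability_symbol_fps[OF \<beta> c] r] unfolding Q_def by simp
  then show ?thesis
    by (auto intro!: boundedI)
qed

text \<open>
  Without the right-hand side the triangular system is homogeneous in
  \<open>\<rho>\<^sup>n - \<rho>\<^sup>0 - d\<^sub>0 n\<tau>\<close>, which vanishes at \<open>n = 0\<close>.
\<close>

lemma amplitude_sequence_linear: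
  assumes \<rho>: "amplitude_sequence \<beta> \<mu> \<tau> h \<sigma> \<rho>0 d0 \<rho>"
    and S: "S_star \<beta> \<mu> \<tau> h \<sigma> = 0"
  shows "\<rho> n = \<rho>0 + d0 * of_real (real n * \<tau>)"
proof (induction n rule: less_induct)
  case (less n)
  have \<rho>0: "\<rho> 0 = \<rho>0" using \<rho> by (simp add: amplitude_sequence_def)
  show ?case
  proof (cases "n = 0")
    case False
    then have "amplitude_equation \<beta> \<mu> \<tau> h \<sigma> d0 \<rho> n"
      using \<rho> by (simp add: amplitude_sequence_def)
    then have "(\<Sum>k\<le>n. of_real (alpha \<beta> (n - k)) * (\<rho> k - \<rho> 0 - d0 * of_real (real k * \<tau>))) = 0"
      by (simp add: amplitude_equation_def S)
    also have "(\<Sum>k\<le>n. of_real (alpha \<beta> (n - k)) * (\<rho> k - \<rho> 0 - d0 * of_real (real k * \<tau>)))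
        = (\<Sum>k<n. of_real (alpha \<beta> (n - k)) * (\<rho> k - \<rho> 0 - d0 * of_real (real k * \<tau>)))
          + (\<rho> n - \<rho> 0 - d0 * of_real (real n * \<tau>))"
      by (simp flip: lessThan_Suc_atMost)
    also have "(\<Sum>k<n. of_real (alpha \<beta> (n - k)) * (\<rho> k - \<rho> 0 - d0 * of_real (real k * \<tau>))) = 0"
      using less \<rho>0 by (intro sum.neutral) auto
    finally show ?thesis using \<rho>0 by (simp add: algebra_simps)
  qed (use \<rho>0 in simp)
qed

theorem theorem1:
  shows "\<exists>K :: complex \<Rightarrow> complex \<Rightarrow> real \<Rightarrow> real. \<forall>\<beta> \<mu> T a b :: real.
    1 < \<beta> \<longrightarrow> \<beta> < 2 \<longrightarrow> 0 < \<mu> \<longrightarrow> 0 < T \<longrightarrow> a < b \<longrightarrow>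
      (\<forall>\<tau> h \<sigma> d0 \<rho> \<phi>0 \<psi>0. 0 < \<tau> \<longrightarrow> 0 < h \<longrightarrow>
         (\<forall>j. \<phi>0 (grid_point a h j) = \<rho> 0 * fourier_mode \<sigma> h j) \<longrightarrow>
         (\<forall>j. \<psi>0 (grid_point a h j) = d0 * fourier_mode \<sigma> h j) \<longrightarrow>
         (\<forall>n\<ge>1. \<forall>j.
            interior_equation \<beta> \<mu> \<tau> h a \<phi>0 \<psi>0 (\<lambda>k j. 0) (\<lambda>k j. \<rho> k * fourier_mode \<sigma> h j) n j
            \<longleftrightarrow> amplitude_equation \<beta> \<mu> \<tau> h \<sigma> d0 \<rho> n))
      \<and> fourier_stable K \<beta> \<mu> T"
proof (intro exI[of _ "\<lambda>\<rho>0 d0 T. norm \<rho>0 + norm d0 * T"] allI impI conjI)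
  fix \<beta> \<mu> T a b \<tau> h \<sigma> :: real and d0 :: complex and \<rho> :: "nat \<Rightarrow> complex" and \<phi>0 \<psi>0 :: "real \<Rightarrow> complex"
    and n :: nat and j :: int
  assume "0 < \<tau>" "\<forall>j. \<phi>0 (grid_point a h j) = \<rho> 0 * fourier_mode \<sigma> h j"
    "\<forall>j. \<psi>0 (grid_point a h j) = d0 * fourier_mode \<sigma> h j"
  then show "interior_equation \<beta> \<mu> \<tau> h a \<phi>0 \<psi>0 (\<lambda>k j. 0) (\<lambda>k j. \<rho> k * fourier_mode \<sigma> h j) n j
      \<longleftrightarrow> amplitude_equation \<beta> \<mu> \<tau> h \<sigma> d0 \<rho> n"
    by (intro interior_equation_fourier_mode) auto
next
  fix \<beta> \<mu> T :: real
  assume \<beta>: "1 < \<beta>" "\<beta> < 2"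
  show "fourier_stable (\<lambda>\<rho>0 d0 T. norm \<rho>0 + norm d0 * T) \<beta> \<mu> T"
    unfolding fourier_stable_def
  proof (intro allI impI conjI)
    fix \<tau> h \<sigma> :: real and \<rho>0 d0 :: complex and \<rho> :: "nat \<Rightarrow> complex"
    assume \<rho>: "amplitude_sequence \<beta> \<mu> \<tau> h \<sigma> \<rho>0 d0 \<rho>"
    show "bounded (range \<rho>)" if "S_star \<beta> \<mu> \<tau> h \<sigma> < 0"
      using amplitude_sequence_bounded[OF \<beta> \<rho> that] .
    show "norm (\<rho> n) \<le> norm \<rho>0 + norm d0 * T"
      if "0 < \<tau>" "S_star \<beta> \<mu> \<tau> h \<sigma> = 0" "real n * \<tau> \<le> T" for n
    proof -
      have "norm (\<rho> n) \<le> norm \<rho>0 + norm (d0 * of_real (real n * \<tau>))"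
        unfolding amplitude_sequence_linear[OF \<rho> that(2)] by (rule norm_triangle_ineq)
      also have "norm (d0 * of_real (real n * \<tau>)) \<le> norm d0 * T"
        unfolding norm_mult norm_of_real using that by (intro mult_left_mono) auto
      finally show ?thesis by simp
    qed
  qed
qed

end
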